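(* For each positive integer $n$, let $Z_{0,n}$ be the zero cell of a stationary Poisson-Voronoi mosaic in $\mathbb{R}^n$ with cell intensity $e^{n\rho_n}$, where $(\rho_n)$ is a real sequence with $\lim_{n\to\infty}\rho_n=\rho\in\mathbb{R}$. Let $Y_n$ be a random vector in $\mathbb{R}^n$ such that, conditioned on $Z_{0,n}$, $Y_n\sim\mathrm{Uniform}(Z_{0,n}-c(Z_{0,n}))$. Then for $R>0$, $$\lim_{n\to\infty}\mathbb{P}(|Y_n|\le\sqrt{n}R)=\begin{cases}0,& R<e^{-\rho}(2\pi e)^{-1/2},\\ 1,& R>e^{-\rho}(2\pi e)^{-1/2}.\end{cases}$$ For $0<R<e^{-\rho}(2\pi e)^{-1/2}$, $$\lim_{n\to\infty}\frac1n\ln\mathbb{P}(|Y_n|\le\sqrt{n}R)=\rho+\frac12\ln(2\pi e)+\ln R,$$ and for $R>e^{-\rho}(2\pi e)^{-1/2}$, $$\lim_{n\to\infty}\frac1n\ln\bigl(-\ln\mathbb{P}(|Y_n|\ge\sqrt{n}R)\bigr)=\rho+\frac12\ln(2\pi e)+\ln R.$$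
   Context: $|\cdot|$ is the Euclidean norm. Let $N$ be a stationary Poisson point process in $\mathbb{R}^n$ with intensity $\lambda\in(0,\infty)$. For $x\in N$ the Voronoi cell with center $x$ is $C(x,N)=\{z\in\mathbb{R}^n: |z-x|\le|z-y|\text{ for all }y\in N\}$. The collection $\{C(x,N):x\in N\}$ is the stationary Poisson-Voronoi mosaic induced by $N$, and its cell intensity is $\lambda$. The center function $c$ assigns to a cell $C(x,N)$ its associated point $x\in N$, i.e. $c(C(x,N))=x$. The zero cell is the (almost surely unique) cell containing the origin. "Conditioned on $Z_0$, $Y\sim\mathrm{Uniform}(Z_0-c(Z_0))$" means that, given the mosaic, $Y$ has the uniform distribution (normalized Lebesgue measure) on the translated cell $Z_0-c(Z_0)$. *)

theory Defs
  imports "HOL-Probability.Probability"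
begin

text \<open>
  The dimension \<open>n\<close> tends to infinity, so it cannot be a type. A point of \<open>R^n\<close> is an
  extensional function on the index set \<open>{..<n}\<close>, an element of
  \<open>{..<n} \<rightarrow>\<^sub>E UNIV\<close>; the Euclidean norm is the library's \<^const>\<open>L2_set\<close>.
\<close>

definition eucl :: "nat \<Rightarrow> (nat \<Rightarrow> real) measure" where
  "eucl n = Pi\<^sub>M {..<n} (\<lambda>_. lborel)"

definition enorm :: "nat \<Rightarrow> (nat \<Rightarrow> real) \<Rightarrow> real" where
  "enorm n x = L2_set x {..<n}"

definition origin :: "nat \<Rightarrow> (nat \<Rightarrow> real)" where
  "origin n = (\<lambda>i\<in>{..<n}. 0)"

definition vminus :: "nat \<Rightarrow> (nat \<Rightarrow> real) \<Rightarrow> (nat \<Rightarrow> real) \<Rightarrow> (nat \<Rightarrow> real)" where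
  "vminus n x y = (\<lambda>i\<in>{..<n}. x i - y i)"

definition bounded_borel :: "nat \<Rightarrow> (nat \<Rightarrow> real) set set" where
  "bounded_borel n = {B \<in> sets (eucl n). \<exists>r. \<forall>x\<in>B. enorm n x \<le> r}"


definition locally_finite :: "nat \<Rightarrow> (nat \<Rightarrow> real) set \<Rightarrow> bool" where
  "locally_finite n S \<longleftrightarrow> S \<subseteq> space (eucl n) \<and> (\<forall>r. finite {x \<in> S. enorm n x \<le> r})"

text \<open>
  The measurable space of locally finite point configurations. Its measure is irrelevant; the
  sigma-algebra is the one that makes all counting maps \<open>S \<mapsto> card (S \<inter> B)\<close>, for bounded Borel
  sets \<open>B\<close>, measurable.
\<close>

definition config_space :: "nat \<Rightarrow> (nat \<Rightarrow> real) set measure" where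
  "config_space n = sigma {S. locally_finite n S}
     {{S. locally_finite n S \<and> card (S \<inter> B) = k} | B k. B \<in> bounded_borel n}"

text \<open>
  A Poisson process whose intensity measure is \<open>l\<close> times Lebesgue measure; this is the
  stationary Poisson process of intensity \<open>l\<close>. The Poisson probabilities are written out
  because \<open>poisson_pmf\<close> excludes the parameter \<open>0\<close>, which occurs for Lebesgue null sets.
\<close>

definition stationary_poisson_process ::
    "nat \<Rightarrow> real \<Rightarrow> 'a measure \<Rightarrow> ('a \<Rightarrow> (nat \<Rightarrow> real) set) \<Rightarrow> bool" where
  "stationary_poisson_process n l M N \<longleftrightarrow>
     0 < l \<and> prob_space M \<and> N \<in> measurable M (config_space n) \<and>
     (\<forall>B\<in>bounded_borel n. \<forall>k::nat.
        \<P>(w in M. card (N w \<inter> B) = k)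
          = (l * measure (eucl n) B) ^ k / fact k * exp (- (l * measure (eucl n) B))) \<and>
     (\<forall>(B :: nat \<Rightarrow> (nat \<Rightarrow> real) set) m.
        (\<forall>i<m. B i \<in> bounded_borel n) \<and> disjoint_family_on B {..<m} \<longrightarrow>
        prob_space.indep_vars M (\<lambda>_. count_space UNIV) (\<lambda>i w. card (N w \<inter> B i)) {..<m})"


definition voronoi_cell :: "nat \<Rightarrow> (nat \<Rightarrow> real) set \<Rightarrow> (nat \<Rightarrow> real) \<Rightarrow> (nat \<Rightarrow> real) set" where
  "voronoi_cell n S x =
     {z \<in> space (eucl n). \<forall>y\<in>S. enorm n (vminus n z x) \<le> enorm n (vminus n z y)}"

definition voronoi_mosaic :: "nat \<Rightarrow> (nat \<Rightarrow> real) set \<Rightarrow> (nat \<Rightarrow> real) set set" where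
  "voronoi_mosaic n S = voronoi_cell n S ` S"

text \<open>
  Cells of distinct points of \<open>S\<close> are distinct, so the center is well defined on the mosaic. The
  zero cell is only almost surely unique; on the exceptional null event it is unspecified.
\<close>

definition center :: "nat \<Rightarrow> (nat \<Rightarrow> real) set \<Rightarrow> (nat \<Rightarrow> real) set \<Rightarrow> (nat \<Rightarrow> real)" where
  "center n S C = (THE x. x \<in> S \<and> voronoi_cell n S x = C)"

definition zero_cell :: "nat \<Rightarrow> (nat \<Rightarrow> real) set \<Rightarrow> (nat \<Rightarrow> real) set" where
  "zero_cell n S = (THE C. C \<in> voronoi_mosaic n S \<and> origin n \<in> C)"

definition centered_zero_cell :: "nat \<Rightarrow> (nat \<Rightarrow> real) set \<Rightarrow> (nat \<Rightarrow> real) set" where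
  "centered_zero_cell n S =
     (\<lambda>z. vminus n z (center n S (zero_cell n S))) ` zero_cell n S"

text \<open>
  Given the mosaic (the sigma-algebra generated by \<open>N\<close>: the cells with their centers carry the
  same information as the points), the conditional distribution of \<open>Y\<close> is normalized Lebesgue
  measure on the random set \<open>D (N w)\<close>.
\<close>

definition cond_uniform_on :: "nat \<Rightarrow> 'a measure \<Rightarrow> ('a \<Rightarrow> (nat \<Rightarrow> real) set) \<Rightarrow>
    ('a \<Rightarrow> (nat \<Rightarrow> real)) \<Rightarrow> ((nat \<Rightarrow> real) set \<Rightarrow> (nat \<Rightarrow> real) set) \<Rightarrow> bool" where
  "cond_uniform_on n M N Y D \<longleftrightarrow>
     Y \<in> measurable M (eucl n) \<and>
     (\<forall>A\<in>sets (eucl n). AE w in M.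
        real_cond_exp M (vimage_algebra (space M) N (config_space n))
          (indicat_real (Y -` A \<inter> space M)) w
        = measure (uniform_measure (eucl n) (D (N w))) A)"

end

theory Submission
  imports Defs "HOL-Real_Asymp.Real_Asymp"
begin

text \<open>
  The origin is a uniform point of its cell up to translation: by stationarity and a mass transport
  from the origin to the points of its cell, \<open>Y\<close> has the same norm distribution as the center of
  the zero cell, which is the point of the process nearest to the origin. Hence
  \<open>P(|Y| \<le> r) = 1 - exp (- a)\<close>, where \<open>a\<close> is the intensity times the volume of the ball of
  radius \<open>r\<close>. For \<open>r = sqrt n * R\<close>, the recursion of the volume of the unit ball in steps of two
  dimensions gives \<open>ln a / n \<rightarrow> \<rho> + ln (2 * pi * e) / 2 + ln R\<close>, whose sign decides whether
  \<open>a\<close> tends to \<open>0\<close> or to infinity.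
\<close>

subsection \<open>Euclidean space on extensional functions\<close>

text \<open>The obstacle is measurability. Mass transport exchanges the integral over
  \<open>t\<close> with the one over the configuration, so everything transported must be jointly
  measurable in both, while the sigma-algebra on configurations is generated by counts in fixed
  bounded sets. Hence no center is selected inside the transported functions: cells enter through
  the relation of having a common nearest point, which is rewritten with countably many hit-or-miss
  events of balls around rational points. Stationarity has to be proved as well: the process is
  specified by its counts, so one shows that these determine its law and that translation preserves
  them. No geometric argument is made for the zero cell having positive finite volume. The
  hypothesis on \<open>Y\<close> yields it: for volume 0 or infinity the normalized measure would
  have total mass 0, but conditional probabilities of the whole space are 1.\<close>

definition pdist :: "nat \<Rightarrow> (nat \<Rightarrow> real) \<Rightarrow> (nat \<Rightarrow> real) \<Rightarrow> real" where
  "pdist n x y = enorm n (vminus n x y)"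

lemma pdist_L2: "pdist n x y = L2_set (\<lambda>i. x i - y i) {..<n}"
  unfolding pdist_def enorm_def vminus_def by (rule L2_set_cong) auto

lemma pdist_nonneg [simp]: "0 \<le> pdist n x y"
  by (simp add: pdist_L2)

lemma pdist_self [simp]: "pdist n x x = 0"
  by (simp add: pdist_L2 L2_set_0')

lemma pdist_commute: "pdist n x y = pdist n y x"
  by (simp add: pdist_L2 L2_set_def power2_commute)

lemma pdist_triangle: "pdist n x z \<le> pdist n x y + pdist n y z"
proof -
  have "L2_set (\<lambda>i. (x i - y i) + (y i - z i)) {..<n}
    \<le> L2_set (\<lambda>i. x i - y i) {..<n} + L2_set (\<lambda>i. y i - z i) {..<n}"
    by (rule L2_set_triangle_ineq)
  then show ?thesis by (simp add: pdist_L2)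
qed

lemma pdist_origin [simp]: "pdist n x (origin n) = enorm n x" "pdist n (origin n) x = enorm n x"
proof -
  show "pdist n x (origin n) = enorm n x"
    unfolding pdist_L2 enorm_def origin_def by (rule L2_set_cong) auto
  then show "pdist n (origin n) x = enorm n x" by (simp add: pdist_commute)
qed

lemma enorm_nonneg [simp]: "0 \<le> enorm n x"
  by (simp add: enorm_def)

lemma enorm_le_pdist: "enorm n x \<le> enorm n y + pdist n x y"
  using pdist_triangle[of n x "origin n" y] by simp

lemma pdist_vminus_right [simp]: "pdist n (vminus n x t) (vminus n y t) = pdist n x y"
  unfolding pdist_L2 vminus_def by (rule L2_set_cong) auto

lemma space_eucl: "space (eucl n) = {..<n} \<rightarrow>\<^sub>E UNIV"
  by (simp add: eucl_def space_PiM)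

lemma space_eucl_ext: "x \<in> space (eucl n) \<Longrightarrow> y \<in> space (eucl n) \<Longrightarrow> (\<And>i. i < n \<Longrightarrow> x i = y i) \<Longrightarrow> x = y"
  unfolding space_eucl by (auto intro: PiE_ext)

lemma pdist_eq_0: "x \<in> space (eucl n) \<Longrightarrow> y \<in> space (eucl n) \<Longrightarrow> pdist n x y = 0 \<Longrightarrow> x = y"
  by (rule space_eucl_ext) (auto simp: pdist_L2 L2_set_eq_0_iff)

lemma origin_in_space [simp]: "origin n \<in> space (eucl n)"
  by (auto simp: origin_def space_eucl)

lemma vminus_in_space [simp]: "vminus n x y \<in> space (eucl n)"
  by (auto simp: vminus_def space_eucl)

lemma vminus_self [simp]: "vminus n x x = origin n"
  by (auto simp: vminus_def origin_def)

text \<open>\<open>vminus n (origin n) t\<close> plays the part of -t, so subtracting it undoes the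
  subtraction of \<open>t\<close>. The point must lie in the space because \<open>vminus\<close>
  forgets the values outside \<open>{..<n}\<close>.\<close>

lemma vminus_vminus_origin [simp]:
  "x \<in> space (eucl n) \<Longrightarrow> vminus n (vminus n x t) (vminus n (origin n) t) = x"
  by (rule space_eucl_ext[of _ n]) (simp, simp, simp add: vminus_def origin_def)

lemma vminus_vminus_origin' [simp]:
  "x \<in> space (eucl n) \<Longrightarrow> vminus n (vminus n x (vminus n (origin n) t)) t = x"
  by (rule space_eucl_ext[of _ n]) (simp, simp, simp add: vminus_def origin_def)

lemma inj_on_vminus: "inj_on (\<lambda>x. vminus n x t) (space (eucl n))"
  by (rule inj_on_inverseI[of _ "\<lambda>x. vminus n x (vminus n (origin n) t)"]) simp

lemma measurable_eucl_component:
  assumes "f \<in> measurable M (eucl n)" "i < n"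
  shows "(\<lambda>x. f x i) \<in> borel_measurable M"
proof -
  have "(\<lambda>x. f x i) \<in> measurable M lborel"
    using measurable_compose[OF assms(1)[unfolded eucl_def] measurable_component_singleton] assms(2) by simp
  then show ?thesis by simp
qed

lemma measurable_pdist [measurable]:
  assumes "f \<in> measurable M (eucl n)" "g \<in> measurable M (eucl n)"
  shows "(\<lambda>x. pdist n (f x) (g x)) \<in> borel_measurable M"
proof -
  have "(\<lambda>x. (f x i - g x i)\<^sup>2) \<in> borel_measurable M" if "i < n" for i
    using assms that
    by (intro borel_measurable_power borel_measurable_diff measurable_eucl_component)
  then have "(\<lambda>x. \<Sum>i<n. (f x i - g x i)\<^sup>2) \<in> borel_measurable M"
    by (intro borel_measurable_sum) auto
  then show ?thesis unfolding pdist_L2 L2_set_def by measurable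
qed

lemma measurable_enorm [measurable]: "enorm n \<in> borel_measurable (eucl n)"
proof -
  have "(\<lambda>x. pdist n x (origin n)) \<in> borel_measurable (eucl n)"
    by (rule measurable_pdist) auto
  then show ?thesis by simp
qed

lemma measurable_vminus_right [measurable]:
  "(\<lambda>x. vminus n x t) \<in> measurable (eucl n) (eucl n)"
  unfolding vminus_def eucl_def
  by (intro measurable_restrict) (auto intro!: borel_measurable_diff measurable_eucl_component[unfolded eucl_def, of "\<lambda>x. x"])

lemma measurable_vminus_left [measurable]:
  "(\<lambda>x. vminus n t x) \<in> measurable (eucl n) (eucl n)"
  unfolding vminus_def eucl_def
  by (intro measurable_restrict) (auto intro!: borel_measurable_diff measurable_eucl_component[unfolded eucl_def, of "\<lambda>x. x"])

lemma sigma_finite_eucl: "sigma_finite_measure (eucl n)"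
proof -
  interpret finite_product_sigma_finite "\<lambda>_. lborel :: real measure" "{..<n}" by standard auto
  show ?thesis unfolding eucl_def by (rule sigma_finite_measure_axioms)
qed

text \<open>A product measure is determined by its boxes, so the one-dimensional invariance
  suffices. The factor \<open>c\<close> lets one proof cover translations (c = 1) and the reflection
  needed at the end of mass transport (c = -1).\<close>

lemma distr_eucl_affine:
  assumes "\<bar>c\<bar> = 1"
  shows "distr (eucl n) (eucl n) (\<lambda>x. \<lambda>i\<in>{..<n}. t i + c * x i) = eucl n"
proof -
  interpret product_sigma_finite "\<lambda>_::nat. lborel :: real measure" by standard
  have m: "(\<lambda>x. \<lambda>i\<in>{..<n}. t i + c * x i) \<in> measurable (eucl n) (eucl n)"
    unfolding eucl_def
    by (intro measurable_restrict) (auto intro!: borel_measurable_add borel_measurable_times measurable_eucl_component[unfolded eucl_def, of "\<lambda>x. x"])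
  have aff: "distr lborel borel (\<lambda>x. a + c * x) = (lborel :: real measure)" for a
    using lborel_real_affine[of c a] assms by (simp add: density_1 one_ennreal_def[symmetric])
  show ?thesis
    unfolding eucl_def
  proof (rule PiM_eqI)
    fix A :: "nat \<Rightarrow> real set"
    assume A: "\<And>i. i \<in> {..<n} \<Longrightarrow> A i \<in> sets lborel"
    have "emeasure (distr (Pi\<^sub>M {..<n} (\<lambda>_. lborel)) (Pi\<^sub>M {..<n} (\<lambda>_. lborel)) (\<lambda>x. \<lambda>i\<in>{..<n}. t i + c * x i)) (Pi\<^sub>E {..<n} A)
      = emeasure (Pi\<^sub>M {..<n} (\<lambda>_. lborel)) ((\<lambda>x. \<lambda>i\<in>{..<n}. t i + c * x i) -` Pi\<^sub>E {..<n} A \<inter> space (Pi\<^sub>M {..<n} (\<lambda>_. lborel)))"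
      using m A by (intro emeasure_distr) (auto simp: eucl_def intro!: sets_PiM_I_finite)
    also have "(\<lambda>x. \<lambda>i\<in>{..<n}. t i + c * x i) -` Pi\<^sub>E {..<n} A \<inter> space (Pi\<^sub>M {..<n} (\<lambda>_. lborel))
      = Pi\<^sub>E {..<n} (\<lambda>i. (\<lambda>x. t i + c * x) -` A i)"
      by (auto simp: space_PiM PiE_def Pi_def)
    also have "emeasure (Pi\<^sub>M {..<n} (\<lambda>_. lborel)) \<dots> = (\<Prod>i<n. emeasure lborel ((\<lambda>x. t i + c * x) -` A i))"
    proof (rule emeasure_PiM)
      fix i assume "i \<in> {..<n}"
      then have "(\<lambda>x. t i + c * x) -` A i \<inter> space borel \<in> sets borel"
        using A by (intro measurable_sets[of _ borel borel]) auto
      then show "(\<lambda>x. t i + c * x) -` A i \<in> sets lborel" by simp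
    qed simp
    also have "\<dots> = (\<Prod>i<n. emeasure (distr lborel borel (\<lambda>x. t i + c * x)) (A i))"
      using A by (intro prod.cong) (auto simp: emeasure_distr)
    also have "\<dots> = (\<Prod>i<n. emeasure lborel (A i))" by (simp add: aff)
    finally show "emeasure (distr (Pi\<^sub>M {..<n} (\<lambda>_. lborel)) (Pi\<^sub>M {..<n} (\<lambda>_. lborel)) (\<lambda>x. \<lambda>i\<in>{..<n}. t i + c * x i)) (Pi\<^sub>E {..<n} A)
      = (\<Prod>i\<in>{..<n}. emeasure lborel (A i))" .
  qed auto
qed

lemma distr_eucl_translate: "distr (eucl n) (eucl n) (\<lambda>x. vminus n x t) = eucl n"
  using distr_eucl_affine[of 1 n "\<lambda>i. - t i"] by (simp add: vminus_def)

lemma distr_eucl_reflect: "distr (eucl n) (eucl n) (\<lambda>x. vminus n t x) = eucl n"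
  using distr_eucl_affine[of "-1" n t] by (simp add: vminus_def)

lemma nn_integral_eucl_translate:
  assumes "f \<in> borel_measurable (eucl n)"
  shows "(\<integral>\<^sup>+x. f (vminus n x t) \<partial>eucl n) = (\<integral>\<^sup>+x. f x \<partial>eucl n)"
  using nn_integral_distr[OF measurable_vminus_right, of f] assms by (simp add: distr_eucl_translate)

lemma nn_integral_eucl_reflect:
  assumes "f \<in> borel_measurable (eucl n)"
  shows "(\<integral>\<^sup>+x. f (vminus n t x) \<partial>eucl n) = (\<integral>\<^sup>+x. f x \<partial>eucl n)"
  using nn_integral_distr[OF measurable_vminus_left, of f] assms by (simp add: distr_eucl_reflect)

lemma emeasure_eucl_translate:
  assumes "B \<in> sets (eucl n)"
  shows "emeasure (eucl n) {x \<in> space (eucl n). vminus n x t \<in> B} = emeasure (eucl n) B"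
proof -
  have "emeasure (distr (eucl n) (eucl n) (\<lambda>x. vminus n x t)) B
    = emeasure (eucl n) ((\<lambda>x. vminus n x t) -` B \<inter> space (eucl n))"
    using assms by (intro emeasure_distr) auto
  also have "(\<lambda>x. vminus n x t) -` B \<inter> space (eucl n) = {x \<in> space (eucl n). vminus n x t \<in> B}" by auto
  finally show ?thesis by (simp add: distr_eucl_translate)
qed

lemma emeasure_eucl_ball:
  assumes "n \<ge> 1" "r \<ge> 0"
  shows "emeasure (eucl n) {x \<in> space (eucl n). enorm n x \<le> r} = ennreal (unit_ball_vol n * r ^ n)"
\<comment> \<open>Radius 0 has to be covered: it is the inner radius of the first shell in
  \<open>poisson_no_ties\<close>. The ball is then a one-point box, which is null because
  \<open>n\<close> is positive.\<close>
proof (cases "r = 0")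
  case True
  interpret product_sigma_finite "\<lambda>_::nat. lborel :: real measure" by standard
  have "{x \<in> space (eucl n). enorm n x \<le> r} = Pi\<^sub>E {..<n} (\<lambda>_. {0})"
  proof (intro equalityI subsetI)
    fix x assume x: "x \<in> {x \<in> space (eucl n). enorm n x \<le> r}"
    then have "enorm n x = 0" using True enorm_nonneg[of n x] by auto
    then show "x \<in> Pi\<^sub>E {..<n} (\<lambda>_. {0})"
      using x by (auto simp: enorm_def L2_set_eq_0_iff space_eucl PiE_def restrict_def extensional_def fun_eq_iff)
  qed (auto simp: space_eucl PiE_def enorm_def True L2_set_0')
  then show ?thesis
    using True assms emeasure_PiM[of "{..<n}" "\<lambda>_. {0}"] by (simp add: eucl_def power_0_left del: PiE_singleton)
next
  case False
  have "{x \<in> space (eucl n). enorm n x \<le> r} = {f. sqrt (\<Sum>i\<in>{..<n}. (f i)\<^sup>2) \<le> r} \<inter> space (Pi\<^sub>M {..<n} (\<lambda>_. lborel))"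
    by (auto simp: enorm_def L2_set_def eucl_def)
  then show ?thesis
    using emeasure_cball_aux[of "{..<n}" r] False assms by (simp add: eucl_def)
qed

text \<open>An enumeration of a countable dense set; indexing by naturals turns quantifiers over
  points into countable ones.\<close>

definition ratpt :: "nat \<Rightarrow> nat \<Rightarrow> nat \<Rightarrow> real" where
  "ratpt n = from_nat_into ({..<n} \<rightarrow>\<^sub>E \<rat>)"

lemma rat_PiE: "countable ({..<n::nat} \<rightarrow>\<^sub>E (\<rat> :: real set))" "({..<n::nat} \<rightarrow>\<^sub>E (\<rat> :: real set)) \<noteq> {}"
  by (auto intro!: countable_PiE finite_lessThan simp: countable_rat PiE_eq_empty_iff)

lemma ratpt_in_space [simp]: "ratpt n i \<in> space (eucl n)"
  using from_nat_into[OF rat_PiE(2)] by (auto simp: ratpt_def space_eucl PiE_def)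

lemma ratpt_approx:
  assumes "0 < e"
  shows "\<exists>i. pdist n x (ratpt n i) \<le> e"
proof -
  \<comment> \<open>The Euclidean distance is at most the sum of the coordinate distances, so the
    tolerance is shared among the coordinates; the added 1 avoids dividing by 0 in dimension
    0.\<close>
  have "\<exists>q\<in>\<rat>. \<bar>x i - q\<bar> < e / (real n + 1)" for i
  proof -
    have "x i - e / (real n + 1) < x i + e / (real n + 1)" using assms by simp
    from Rats_dense_in_real[OF this] show ?thesis by (force simp: abs_less_iff)
  qed
  then obtain q where q: "\<And>i. q i \<in> \<rat>" "\<And>i. \<bar>x i - q i\<bar> < e / (real n + 1)" by metis
  have "restrict q {..<n} \<in> {..<n} \<rightarrow>\<^sub>E \<rat>" using q by auto
  then obtain i where i: "ratpt n i = restrict q {..<n}"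
    unfolding ratpt_def using rat_PiE(1) by (metis from_nat_into_surj)
  have "pdist n x (ratpt n i) \<le> (\<Sum>j<n. \<bar>x j - ratpt n i j\<bar>)"
    unfolding pdist_L2 by (rule L2_set_le_sum_abs)
  also have "\<dots> \<le> (\<Sum>j<n. e / (real n + 1))"
    using q by (intro sum_mono) (auto simp: i intro: less_imp_le)
  also have "\<dots> \<le> e" using assms by (simp add: field_simps)
  finally show ?thesis by blast
qed

subsection \<open>The space of locally finite configurations\<close>

lemma space_config: "space (config_space n) = {S. locally_finite n S}"
  and sets_config: "sets (config_space n) = sigma_sets {S. locally_finite n S}
     {{S. locally_finite n S \<and> card (S \<inter> B) = k} | B k. B \<in> bounded_borel n}"
  unfolding config_space_def by (auto simp: space_measure_of_conv intro!: sets_measure_of)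

lemma locally_finite_finite_Int:
  assumes "locally_finite n S" "B \<in> bounded_borel n"
  shows "finite (S \<inter> B)"
proof -
  obtain r where "\<forall>x\<in>B. enorm n x \<le> r" using assms(2) by (auto simp: bounded_borel_def)
  then have "S \<inter> B \<subseteq> {x\<in>S. enorm n x \<le> r}" by auto
  then show ?thesis using assms(1) by (auto simp: locally_finite_def intro: finite_subset)
qed

lemma measurable_card_Int:
  assumes "B \<in> bounded_borel n"
  shows "(\<lambda>S. card (S \<inter> B)) \<in> measurable (config_space n) (count_space UNIV)"
proof (subst measurable_count_space_eq2_countable, intro conjI ballI)
  fix k :: nat
  have "(\<lambda>S. card (S \<inter> B)) -` {k} \<inter> space (config_space n) = {S. locally_finite n S \<and> card (S \<inter> B) = k}"
    by (auto simp: space_config)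
  then show "(\<lambda>S. card (S \<inter> B)) -` {k} \<inter> space (config_space n) \<in> sets (config_space n)"
    using assms by (auto simp: sets_config)
qed auto

lemma measurable_into_config:
  assumes "\<And>x. x \<in> space M \<Longrightarrow> locally_finite n (F x)"
    and "\<And>B. B \<in> bounded_borel n \<Longrightarrow> (\<lambda>x. card (F x \<inter> B)) \<in> measurable M (count_space UNIV)"
  shows "F \<in> measurable M (config_space n)"
proof (rule measurable_sigma_sets[OF sets_config])
  fix C assume "C \<in> {{S. locally_finite n S \<and> card (S \<inter> B) = k} | B k. B \<in> bounded_borel n}"
  then obtain B k where C: "C = {S. locally_finite n S \<and> card (S \<inter> B) = k}" "B \<in> bounded_borel n" by auto
  have "F -` C \<inter> space M = (\<lambda>x. card (F x \<inter> B)) -` {k} \<inter> space M"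
    using assms(1) by (auto simp: C)
  also have "\<dots> \<in> sets M" using assms(2)[OF C(2)] by (rule measurable_sets) simp
  finally show "F -` C \<inter> space M \<in> sets M" .
qed (use assms(1) in auto)

section \<open>Balls that contain a point of the configuration\<close>

lemma cball_bounded_borel: "{x \<in> space (eucl n). pdist n q x \<le> r} \<in> bounded_borel n"
  if "q \<in> space (eucl n)"
proof -
  have "(\<lambda>x. pdist n q x) \<in> borel_measurable (eucl n)"
    using that by (intro measurable_pdist) auto
  then have "{x \<in> space (eucl n). pdist n q x \<le> r} \<in> sets (eucl n)" by measurable
  moreover have "enorm n x \<le> enorm n q + r" if "pdist n q x \<le> r" for x
    using enorm_le_pdist[of n x q] that by (simp add: pdist_commute)
  ultimately show ?thesis unfolding bounded_borel_def by blast
qed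

definition hit :: "nat \<Rightarrow> (nat \<Rightarrow> real) \<Rightarrow> real \<Rightarrow> (nat \<Rightarrow> real) set \<Rightarrow> bool" where
  "hit n q r S \<longleftrightarrow> (\<exists>x\<in>S. pdist n q x \<le> r)"

lemma hit_iff_card:
  assumes "locally_finite n S" "q \<in> space (eucl n)"
  shows "hit n q r S \<longleftrightarrow> card (S \<inter> {x \<in> space (eucl n). pdist n q x \<le> r}) \<noteq> 0"
  using locally_finite_finite_Int[OF assms(1) cball_bounded_borel[OF assms(2)]] assms(1)
  by (auto simp: hit_def locally_finite_def)

lemma pred_hit_const:
  assumes "q \<in> space (eucl n)"
  shows "Measurable.pred (config_space n) (hit n q r)"
proof -
  have [measurable]: "(\<lambda>S. card (S \<inter> {x \<in> space (eucl n). pdist n q x \<le> r})) \<in> measurable (config_space n) (count_space UNIV)"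
    by (rule measurable_card_Int[OF cball_bounded_borel[OF assms]])
  have "Measurable.pred (config_space n) (\<lambda>S. card (S \<inter> {x \<in> space (eucl n). pdist n q x \<le> r}) \<noteq> 0)"
    by measurable
  then show ?thesis
    by (rule measurable_cong[THEN iffD1, rotated])
      (use assms in \<open>auto simp: space_config hit_iff_card\<close>)
qed

text \<open>The right-hand side tends to \<open>b\<close>. Infinitely many \<open>k\<close> rather
  than all, since the pigeonhole principle below delivers no more.\<close>

lemma le_if_infinitely_often:
  fixes a b c :: real
  assumes "infinite {k. a \<le> b + c / real (Suc k)}"
  shows "a \<le> b"
proof (rule ccontr)
  assume "\<not> a \<le> b"
  have "(\<lambda>k. b + c / real (Suc k)) \<longlonglongrightarrow> b + 0"
    by (intro tendsto_add tendsto_const LIMSEQ_Suc[OF lim_const_over_n])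
  then have "\<forall>\<^sub>F k in sequentially. b + c / real (Suc k) < a"
    using \<open>\<not> a \<le> b\<close> by (intro order_tendstoD(2)) auto
  then obtain K where "\<And>k. k \<ge> K \<Longrightarrow> b + c / real (Suc k) < a"
    by (auto simp: eventually_sequentially)
  then have "{k. a \<le> b + c / real (Suc k)} \<subseteq> {..<K}" by (auto simp: not_le[symmetric])
  then show False using assms finite_subset by blast
qed

text \<open>The substitute for compactness: the witness may change with \<open>k\<close>, but only
  finitely many points of \<open>S\<close> have norm at most \<open>K\<close>, so one of them serves
  infinitely often.\<close>

lemma locally_finite_pigeonhole:
  assumes "locally_finite n S" "\<And>k::nat. \<exists>x\<in>S. enorm n x \<le> K \<and> Q k x"
  shows "\<exists>x\<in>S. infinite {k. Q k x}"
proof -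
  have "\<exists>x\<in>{x\<in>S. enorm n x \<le> K}. infinite {k \<in> UNIV. Q k x}"
    using assms by (intro pigeonhole_infinite_rel) (auto simp: locally_finite_def Bex_def)
  then show ?thesis by auto
qed

text \<open>On the right, \<open>S\<close> enters only through hits of fixed balls, which are
  counting events, and \<open>t\<close> only through distances to fixed points; this is what makes
  the event jointly measurable. Approximate hits for all \<open>k\<close> force an exact one because
  \<open>S\<close> is locally finite.\<close>

lemma hit_iff_ratpt:
  assumes "locally_finite n S"
  shows "hit n t r S \<longleftrightarrow>
    (\<forall>k. \<exists>i. pdist n t (ratpt n i) \<le> r + 1 / real (Suc k) \<and> hit n (ratpt n i) (1 / real (Suc k)) S)"
    (is "_ \<longleftrightarrow> ?R")
proof
  assume "hit n t r S"
  then obtain x where x: "x \<in> S" "pdist n t x \<le> r" by (auto simp: hit_def)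
  show ?R
  proof
    fix k
    obtain i where i: "pdist n x (ratpt n i) \<le> 1 / real (Suc k)"
      using ratpt_approx[of "1 / real (Suc k)"] by auto
    have "pdist n t (ratpt n i) \<le> r + 1 / real (Suc k)"
      using pdist_triangle[of n t "ratpt n i" x] x i by linarith
    moreover have "hit n (ratpt n i) (1 / real (Suc k)) S"
      using i x by (auto simp: hit_def pdist_commute)
    ultimately show "\<exists>i. pdist n t (ratpt n i) \<le> r + 1 / real (Suc k) \<and> hit n (ratpt n i) (1 / real (Suc k)) S"
      by blast
  qed
next
  assume R: ?R
  have "\<exists>x\<in>S. enorm n x \<le> enorm n t + r + 2 \<and> pdist n t x \<le> r + 2 / real (Suc k)" for k
  proof -
    obtain i where i: "pdist n t (ratpt n i) \<le> r + 1 / real (Suc k)" "hit n (ratpt n i) (1 / real (Suc k)) S"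
      using R by blast
    then obtain x where x: "x \<in> S" "pdist n (ratpt n i) x \<le> 1 / real (Suc k)" by (auto simp: hit_def)
    have two: "2 / real (Suc k) = 1 / real (Suc k) + 1 / real (Suc k)" by simp
    have "pdist n t x \<le> r + 2 / real (Suc k)"
      using pdist_triangle[of n t x "ratpt n i"] i(1) x(2) two by linarith
    moreover have "2 / real (Suc k) \<le> 2" by (simp add: field_simps)
    ultimately show ?thesis using enorm_le_pdist[of n x t] x(1)
      by (intro bexI[of _ x]) (auto simp: pdist_commute)
  qed
  from locally_finite_pigeonhole[where Q = "\<lambda>k x. pdist n t x \<le> r + 2 / real (Suc k)", OF assms this]
  obtain x where "x \<in> S" "infinite {k. pdist n t x \<le> r + 2 / real (Suc k)}" by (rule bexE)
  then show "hit n t r S" using le_if_infinitely_often by (auto simp: hit_def)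
qed

lemma pred_hit [measurable]:
  assumes [measurable]: "f \<in> measurable M (eucl n)" "F \<in> measurable M (config_space n)"
  shows "Measurable.pred M (\<lambda>x. hit n (f x) r (F x))"
proof -
  have h: "Measurable.pred M (\<lambda>x. hit n (ratpt n i) e (F x))" for i e
    by (rule measurable_compose[OF assms(2) pred_hit_const]) simp
  have d: "(\<lambda>x. pdist n (f x) (ratpt n i)) \<in> borel_measurable M" for i
    by (intro measurable_pdist) auto
  note [measurable] = h d
  have "Measurable.pred M (\<lambda>x. \<forall>k. \<exists>i. pdist n (f x) (ratpt n i) \<le> r + 1 / real (Suc k)
      \<and> hit n (ratpt n i) (1 / real (Suc k)) (F x))"
    by measurable
  then show ?thesis
    by (rule measurable_cong[THEN iffD1, rotated])
      (rule hit_iff_ratpt[symmetric], use measurable_space[OF assms(2)] in \<open>simp add: space_config\<close>)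
qed

section \<open>Measurability of sharing a Voronoi cell\<close>

definition nearest :: "nat \<Rightarrow> (nat \<Rightarrow> real) set \<Rightarrow> (nat \<Rightarrow> real) \<Rightarrow> (nat \<Rightarrow> real) \<Rightarrow> bool" where
  "nearest n S s x \<longleftrightarrow> (\<forall>y\<in>S. pdist n s x \<le> pdist n s y)"

text \<open>Three points are needed: the origin, the target \<open>t\<close> of the transport, and
  the variable over which the volume of their common cell is integrated. No center is chosen, so the
  relation is symmetric and invariant under translation.\<close>

definition same_cell :: "nat \<Rightarrow> (nat \<Rightarrow> real) set \<Rightarrow> (nat \<Rightarrow> real) \<Rightarrow> (nat \<Rightarrow> real) \<Rightarrow> (nat \<Rightarrow> real) \<Rightarrow> bool" where
  "same_cell n S u v w \<longleftrightarrow> (\<exists>x\<in>S. nearest n S u x \<and> nearest n S v x \<and> nearest n S w x)"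

text \<open>The distance from \<open>s\<close> to \<open>q\<close> exceeds the distance from \<open>s\<close> to \<open>S\<close> by at most \<open>1 / (k + 1)\<close>,
  phrased with countably many events so that it is measurable in \<open>s\<close> and \<open>S\<close> jointly.\<close>

definition near_approx :: "nat \<Rightarrow> (nat \<Rightarrow> real) set \<Rightarrow> nat \<Rightarrow> (nat \<Rightarrow> real) \<Rightarrow> (nat \<Rightarrow> real) \<Rightarrow> bool" where
  "near_approx n S k s q \<longleftrightarrow> (\<forall>i m. hit n (ratpt n i) (1 / real (Suc m)) S \<longrightarrow>
     pdist n s q \<le> pdist n s (ratpt n i) + 1 / real (Suc m) + 1 / real (Suc k))"

lemma near_approxI:
  assumes "nearest n S s x" "pdist n x q \<le> 1 / real (Suc k)"
  shows "near_approx n S k s q"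
  unfolding near_approx_def hit_def
proof safe
  fix i m y assume y: "y \<in> S" "pdist n (ratpt n i) y \<le> 1 / real (Suc m)"
  have "pdist n s x \<le> pdist n s y" using assms y by (auto simp: nearest_def)
  then show "pdist n s q \<le> pdist n s (ratpt n i) + 1 / real (Suc m) + 1 / real (Suc k)"
    using pdist_triangle[of n s q x] pdist_triangle[of n s y "ratpt n i"] y(2) assms(2) by linarith
qed

text \<open>One \<open>1 / real (Suc k)\<close> is the slack in \<open>near_approx\<close>, the
  other the distance from \<open>q\<close> to \<open>x\<close>. The slack in \<open>m\<close>
  vanishes, because \<open>y\<close> has rational points within \<open>1 / real (Suc m)\<close> for
  every \<open>m\<close>.\<close>

lemma near_approxD:
  assumes "near_approx n S k s q" "pdist n q x \<le> 1 / real (Suc k)" "y \<in> S"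
  shows "pdist n s x \<le> pdist n s y + 2 / real (Suc k)"
proof -
  have "pdist n s q \<le> pdist n s y + 1 / real (Suc k) + 2 / real (Suc m)" for m
  proof -
    obtain i where i: "pdist n y (ratpt n i) \<le> 1 / real (Suc m)"
      using ratpt_approx[of "1 / real (Suc m)"] by auto
    then have "hit n (ratpt n i) (1 / real (Suc m)) S"
      using assms(3) by (auto simp: hit_def pdist_commute)
    then have "pdist n s q \<le> pdist n s (ratpt n i) + 1 / real (Suc m) + 1 / real (Suc k)"
      using assms(1) by (auto simp: near_approx_def)
    then show ?thesis using pdist_triangle[of n s "ratpt n i" y] i by (simp add: add_divide_distrib[symmetric])
  qed
  then have "pdist n s q \<le> pdist n s y + 1 / real (Suc k)"
    by (intro le_if_infinitely_often[of _ _ 2]) simp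
  moreover have "2 / real (Suc k) = 1 / real (Suc k) + 1 / real (Suc k)" by simp
  ultimately show ?thesis
    using pdist_triangle[of n s x q] assms(2) pdist_commute[of n x q] by linarith
qed

lemma same_cell_iff_ratpt:
  assumes "locally_finite n S"
  shows "same_cell n S u v w \<longleftrightarrow>
    (\<forall>k. \<exists>i. hit n (ratpt n i) (1 / real (Suc k)) S \<and> near_approx n S k u (ratpt n i)
       \<and> near_approx n S k v (ratpt n i) \<and> near_approx n S k w (ratpt n i))"
    (is "_ \<longleftrightarrow> ?R")
proof
  assume "same_cell n S u v w"
  then obtain x where x: "x \<in> S" "nearest n S u x" "nearest n S v x" "nearest n S w x"
    by (auto simp: same_cell_def)
  show ?R
  proof
    fix k
    obtain i where i: "pdist n x (ratpt n i) \<le> 1 / real (Suc k)"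
      using ratpt_approx[of "1 / real (Suc k)"] by auto
    then show "\<exists>i. hit n (ratpt n i) (1 / real (Suc k)) S \<and> near_approx n S k u (ratpt n i)
       \<and> near_approx n S k v (ratpt n i) \<and> near_approx n S k w (ratpt n i)"
      using x near_approxI by (intro exI[of _ i]) (auto simp: hit_def pdist_commute)
  qed
next
  assume R: ?R
  obtain y0 where y0: "y0 \<in> S" using R by (auto simp: hit_def)
  \<comment> \<open>One predicate for all three points, so that the pigeonhole principle returns a
    single common center; \<open>y0\<close> bounds the candidates uniformly in
    \<open>k\<close>.\<close>
  define Q where "Q k x \<longleftrightarrow> (\<forall>y\<in>S. pdist n u x \<le> pdist n u y + 2 / real (Suc k)
      \<and> pdist n v x \<le> pdist n v y + 2 / real (Suc k) \<and> pdist n w x \<le> pdist n w y + 2 / real (Suc k))" for k x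
  have "\<exists>x\<in>S. enorm n x \<le> enorm n u + pdist n u y0 + 2 \<and> Q k x" for k
  proof -
    obtain i where i: "hit n (ratpt n i) (1 / real (Suc k)) S" "near_approx n S k u (ratpt n i)"
       "near_approx n S k v (ratpt n i)" "near_approx n S k w (ratpt n i)"
      using R by blast
    then obtain x where x: "x \<in> S" "pdist n (ratpt n i) x \<le> 1 / real (Suc k)" by (auto simp: hit_def)
    have Q: "Q k x"
      unfolding Q_def using near_approxD[OF i(2) x(2)] near_approxD[OF i(3) x(2)] near_approxD[OF i(4) x(2)] by blast
    moreover have "2 / real (Suc k) \<le> 2" by (simp add: field_simps)
    moreover have "pdist n u x \<le> pdist n u y0 + 2 / real (Suc k)" using Q y0 by (auto simp: Q_def)
    ultimately show ?thesis using enorm_le_pdist[of n x u] x(1)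
      by (intro bexI[of _ x]) (auto simp: pdist_commute)
  qed
  from locally_finite_pigeonhole[where Q = Q, OF assms this]
  obtain x where x: "x \<in> S" "infinite {k. Q k x}" by (rule bexE)
  have "nearest n S s x" if "s \<in> {u, v, w}" for s
    unfolding nearest_def
  proof
    fix y assume "y \<in> S"
    then have "{k. Q k x} \<subseteq> {k. pdist n s x \<le> pdist n s y + 2 / real (Suc k)}"
      using that by (auto simp: Q_def)
    then show "pdist n s x \<le> pdist n s y"
      using x(2) infinite_super le_if_infinitely_often by blast
  qed
  then show "same_cell n S u v w" using x(1) by (auto simp: same_cell_def)
qed

lemma pred_near_approx:
  assumes [measurable]: "f \<in> measurable M (eucl n)" "F \<in> measurable M (config_space n)"
    and q: "q \<in> space (eucl n)"
  shows "Measurable.pred M (\<lambda>x. near_approx n (F x) k (f x) q)"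
proof -
  have h: "Measurable.pred M (\<lambda>x. hit n (ratpt n i) e (F x))" for i e
    by (rule measurable_compose[OF assms(2) pred_hit_const]) simp
  have d: "(\<lambda>x. pdist n (f x) (ratpt n i)) \<in> borel_measurable M"
    "(\<lambda>x. pdist n (f x) q) \<in> borel_measurable M" for i
    using q by (auto intro!: measurable_pdist)
  note [measurable] = h d
  show ?thesis unfolding near_approx_def by measurable
qed

lemma pred_same_cell [measurable]:
  assumes [measurable]: "f \<in> measurable M (eucl n)" "g \<in> measurable M (eucl n)" "h \<in> measurable M (eucl n)"
    "F \<in> measurable M (config_space n)"
  shows "Measurable.pred M (\<lambda>x. same_cell n (F x) (f x) (g x) (h x))"
proof -
  have a: "Measurable.pred M (\<lambda>x. hit n (ratpt n i) e (F x))" for i e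
    by (rule measurable_compose[OF assms(4) pred_hit_const]) simp
  have b: "Measurable.pred M (\<lambda>x. near_approx n (F x) k (f x) (ratpt n i))"
    "Measurable.pred M (\<lambda>x. near_approx n (F x) k (g x) (ratpt n i))"
    "Measurable.pred M (\<lambda>x. near_approx n (F x) k (h x) (ratpt n i))" for k i
    by (intro pred_near_approx; simp)+
  note [measurable] = a b
  have "Measurable.pred M (\<lambda>x. \<forall>k. \<exists>i. hit n (ratpt n i) (1 / real (Suc k)) (F x) \<and> near_approx n (F x) k (f x) (ratpt n i)
       \<and> near_approx n (F x) k (g x) (ratpt n i) \<and> near_approx n (F x) k (h x) (ratpt n i))"
    by measurable
  then show ?thesis
    by (rule measurable_cong[THEN iffD1, rotated])
      (rule same_cell_iff_ratpt[symmetric], use measurable_space[OF assms(4)] in \<open>simp add: space_config\<close>)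
qed

section \<open>Translation of configurations\<close>

definition shift :: "nat \<Rightarrow> (nat \<Rightarrow> real) \<Rightarrow> (nat \<Rightarrow> real) set \<Rightarrow> (nat \<Rightarrow> real) set" where
  "shift n t S = (\<lambda>x. vminus n x t) ` S"

lemma hit_shift [simp]: "hit n (vminus n q t) r (shift n t S) = hit n q r S"
  by (auto simp: hit_def shift_def)

lemma same_cell_shift [simp]:
  "same_cell n (shift n t S) (vminus n u t) (vminus n v t) (vminus n w t) = same_cell n S u v w"
  by (auto simp: same_cell_def nearest_def shift_def)

lemma same_cell_commute: "same_cell n S u v w = same_cell n S v u w"
  by (auto simp: same_cell_def)

lemma locally_finite_shift:
  assumes "locally_finite n S"
  shows "locally_finite n (shift n t S)"
  unfolding locally_finite_def
proof (intro conjI allI)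
  show "shift n t S \<subseteq> space (eucl n)" by (auto simp: shift_def)
  fix r
  have "{x \<in> shift n t S. enorm n x \<le> r} \<subseteq> (\<lambda>x. vminus n x t) ` {x\<in>S. enorm n x \<le> r + enorm n t}"
  proof clarsimp
    fix y assume y: "y \<in> shift n t S" "enorm n y \<le> r"
    then obtain x where x: "x \<in> S" "y = vminus n x t" by (auto simp: shift_def)
    have "enorm n x \<le> enorm n t + pdist n x t" by (rule enorm_le_pdist)
    also have "pdist n x t = enorm n y" by (simp add: x pdist_def)
    finally show "y \<in> (\<lambda>x. vminus n x t) ` {x\<in>S. enorm n x \<le> r + enorm n t}" using x y by auto
  qed
  then show "finite {x \<in> shift n t S. enorm n x \<le> r}"
    using assms by (auto simp: locally_finite_def intro: finite_subset)
qed

lemma card_shift_Int: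
  assumes "S \<subseteq> space (eucl n)"
  shows "card (shift n t S \<inter> B) = card (S \<inter> {x \<in> space (eucl n). vminus n x t \<in> B})"
proof -
  have "shift n t S \<inter> B = (\<lambda>x. vminus n x t) ` (S \<inter> {x \<in> space (eucl n). vminus n x t \<in> B})"
    using assms by (auto simp: shift_def)
  then show ?thesis
    by (auto intro!: card_image inj_on_subset[OF inj_on_vminus])
qed

lemma translate_bounded_borel:
  assumes "B \<in> bounded_borel n"
  shows "{x \<in> space (eucl n). vminus n x t \<in> B} \<in> bounded_borel n"
proof -
  obtain r where r: "\<forall>x\<in>B. enorm n x \<le> r" and B: "B \<in> sets (eucl n)"
    using assms by (auto simp: bounded_borel_def)
  have "enorm n x \<le> enorm n t + r" if "vminus n x t \<in> B" for x
    using enorm_le_pdist[of n x t] r that by (force simp: pdist_def)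
  moreover have "(\<lambda>x. vminus n x t) -` B \<inter> space (eucl n) \<in> sets (eucl n)"
    using B by (rule measurable_sets[OF measurable_vminus_right])
  moreover have "(\<lambda>x. vminus n x t) -` B \<inter> space (eucl n) = {x \<in> space (eucl n). vminus n x t \<in> B}" by auto
  ultimately show ?thesis unfolding bounded_borel_def by auto
qed

lemma measurable_shift: "shift n t \<in> measurable (config_space n) (config_space n)"
proof (rule measurable_into_config)
  fix B assume B: "B \<in> bounded_borel n"
  have "(\<lambda>S. card (S \<inter> {x \<in> space (eucl n). vminus n x t \<in> B})) \<in> measurable (config_space n) (count_space UNIV)"
    by (rule measurable_card_Int[OF translate_bounded_borel[OF B]])
  then show "(\<lambda>S. card (shift n t S \<inter> B)) \<in> measurable (config_space n) (count_space UNIV)"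
    by (rule measurable_cong[THEN iffD1, rotated]) (simp add: space_config card_shift_Int locally_finite_def)
qed (simp add: space_config locally_finite_shift)

subsection \<open>Uniqueness and stationarity of the law of a Poisson process\<close>

lemma poisson_processD:
  assumes "stationary_poisson_process n l M N"
  shows "0 < l" "prob_space M" "N \<in> measurable M (config_space n)"
    "\<And>B k. B \<in> bounded_borel n \<Longrightarrow> measure M {w \<in> space M. card (N w \<inter> B) = k}
          = (l * measure (eucl n) B) ^ k / fact k * exp (- (l * measure (eucl n) B))"
    "\<And>B m. (\<And>i. i < m \<Longrightarrow> B i \<in> bounded_borel n) \<Longrightarrow> disjoint_family_on B {..<m::nat} \<Longrightarrow>
        prob_space.indep_vars M (\<lambda>_. count_space UNIV) (\<lambda>i w. card (N w \<inter> B i)) {..<m}"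
  using assms unfolding stationary_poisson_process_def by blast+

lemma poisson_locally_finite:
  assumes "stationary_poisson_process n l M N" "w \<in> space M"
  shows "locally_finite n (N w)"
  using measurable_space[OF poisson_processD(3)[OF assms(1)] assms(2)] by (simp add: space_config)

lemma poisson_measurable_card:
  assumes "stationary_poisson_process n l M N" "B \<in> bounded_borel n"
  shows "(\<lambda>w. card (N w \<inter> B)) \<in> measurable M (count_space UNIV)"
  by (rule measurable_compose[OF poisson_processD(3)[OF assms(1)] measurable_card_Int[OF assms(2)]])

lemma poisson_count_distr_eq:
  assumes N: "stationary_poisson_process n l M N" and N': "stationary_poisson_process n l M' N'"
    and B: "B \<in> bounded_borel n"
  shows "distr M (count_space UNIV) (\<lambda>w. card (N w \<inter> B)) = distr M' (count_space UNIV) (\<lambda>w. card (N' w \<inter> B))"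
proof (rule measure_eqI_countable[where A = UNIV])
  interpret M: prob_space M by (rule poisson_processD(2)[OF N])
  interpret M': prob_space M' by (rule poisson_processD(2)[OF N'])
  note m = poisson_measurable_card[OF N B] poisson_measurable_card[OF N' B]
  fix k :: nat
  have v: "(\<lambda>w. card (F w \<inter> B)) -` {k} \<inter> A = {w \<in> A. card (F w \<inter> B) = k}" for F :: "'x \<Rightarrow> (nat \<Rightarrow> real) set" and A by auto
  show "emeasure (distr M (count_space UNIV) (\<lambda>w. card (N w \<inter> B))) {k}
    = emeasure (distr M' (count_space UNIV) (\<lambda>w. card (N' w \<inter> B))) {k}"
    using poisson_processD(4)[OF N B, of k] poisson_processD(4)[OF N' B, of k]
    by (simp add: emeasure_distr m v M.emeasure_eq_measure M'.emeasure_eq_measure)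
qed auto

text \<open>Independence makes the joint law of the counts the product of its marginals, and the
  marginals are prescribed. That characterization of independence is for a nonempty index set, hence
  \<open>m > 0\<close>.\<close>

lemma poisson_joint_distr_eq:
  assumes N: "stationary_poisson_process n l M N" and N': "stationary_poisson_process n l M' N'"
    and B: "\<And>i. i < m \<Longrightarrow> B i \<in> bounded_borel n" "disjoint_family_on B {..<m::nat}" and "m > 0"
  shows "distr M (Pi\<^sub>M {..<m} (\<lambda>_. count_space UNIV)) (\<lambda>w. \<lambda>i\<in>{..<m}. card (N w \<inter> B i))
    = distr M' (Pi\<^sub>M {..<m} (\<lambda>_. count_space UNIV)) (\<lambda>w. \<lambda>i\<in>{..<m}. card (N' w \<inter> B i))"
proof -
  have *: "distr M (Pi\<^sub>M {..<m} (\<lambda>_. count_space UNIV)) (\<lambda>w. \<lambda>i\<in>{..<m}. card (N w \<inter> B i))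
    = Pi\<^sub>M {..<m} (\<lambda>i. distr M (count_space UNIV) (\<lambda>w. card (N w \<inter> B i)))"
    if N: "stationary_poisson_process n l M N" for M :: "'x measure" and N
    using poisson_processD(5)[OF N, of m B] B \<open>m > 0\<close>
    by (subst (asm) prob_space.indep_vars_iff_distr_eq_PiM'[OF poisson_processD(2)[OF N]])
      (auto intro: poisson_measurable_card[OF N] B)
  show ?thesis
    unfolding *[OF N] *[OF N'] using poisson_count_distr_eq[OF N N'] B by (intro PiM_cong) auto
qed

text \<open>Any finitely many bounded Borel sets are disjoint unions of the atoms of the algebra they
  generate, and the counts of the atoms are independent.\<close>

lemma poisson_finite_event_eq:
  assumes N: "stationary_poisson_process n l M N" and N': "stationary_poisson_process n l M' N'"
    and F: "finite F" "\<And>B k. (B, k) \<in> F \<Longrightarrow> B \<in> bounded_borel n"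
  shows "emeasure M {w \<in> space M. \<forall>(B, k)\<in>F. card (N w \<inter> B) = k}
    = emeasure M' {w \<in> space M'. \<forall>(B, k)\<in>F. card (N' w \<inter> B) = k}"
proof -
  define Bs where "Bs = fst ` F"
  have Bs: "finite Bs" "\<And>B. B \<in> Bs \<Longrightarrow> B \<in> bounded_borel n"
    using F by (auto simp: Bs_def)
  define p where "p = card (Pow Bs)"
  obtain e where e: "bij_betw e {..<p} (Pow Bs)"
    using ex_bij_betw_nat_finite[of "Pow Bs"] Bs(1) by (auto simp: p_def lessThan_atLeast0)
  have "p > 0" using Bs(1) by (auto simp: p_def card_gt_0_iff)
  \<comment> \<open>The atom of points that lie in exactly the members of \<open>e j\<close>.
    Restricting to the union keeps every atom bounded: the empty subset of \<open>Bs\<close> yields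
    the empty atom instead of an unbounded complement.\<close>
  define A where "A j = {x \<in> \<Union>Bs. \<forall>B\<in>Bs. x \<in> B \<longleftrightarrow> B \<in> e j}" for j
  have A_sets: "A j \<in> bounded_borel n" for j
  proof -
    have "A j = (\<Union>Bs) \<inter> (\<Inter>B\<in>Bs. if B \<in> e j then B else space (eucl n) - B) \<inter> space (eucl n)"
      using Bs(2) by (auto simp: A_def bounded_borel_def split: if_splits dest: sets.sets_into_space)
    also have "\<dots> \<in> sets (eucl n)"
    proof (cases "Bs = {}")
      case False
      then show ?thesis using Bs by (intro sets.Int sets.finite_INT sets.finite_Union) (auto simp: bounded_borel_def)
    qed simp
    finally have "A j \<in> sets (eucl n)" .
    moreover have "\<exists>r. \<forall>B\<in>Bs. \<forall>x\<in>B. enorm n x \<le> r"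
    proof -
      have "\<forall>B\<in>Bs. \<exists>r. \<forall>x\<in>B. enorm n x \<le> r" using Bs(2) by (auto simp: bounded_borel_def)
      then obtain r where r: "\<forall>B\<in>Bs. \<forall>x\<in>B. enorm n x \<le> r B" by metis
      have "enorm n x \<le> (\<Sum>B\<in>Bs. \<bar>r B\<bar>)" if "B \<in> Bs" "x \<in> B" for x B
      proof -
        have "enorm n x \<le> \<bar>r B\<bar>" using r that by force
        also have "\<dots> \<le> (\<Sum>B\<in>Bs. \<bar>r B\<bar>)" using Bs(1) that by (intro member_le_sum) auto
        finally show ?thesis .
      qed
      then show ?thesis by blast
    qed
    ultimately show ?thesis by (fastforce simp: bounded_borel_def A_def)
  qed
  have A_disj: "disjoint_family_on A {..<p}"
    unfolding disjoint_family_on_def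
  proof (intro ballI impI)
    fix i j assume ij: "i \<in> {..<p}" "j \<in> {..<p}" "i \<noteq> j"
    then have "e i \<noteq> e j" "e i \<subseteq> Bs" "e j \<subseteq> Bs"
      using e by (auto simp: bij_betw_def inj_on_def)
    then show "A i \<inter> A j = {}" unfolding A_def by blast
  qed
  have B_eq: "B = (\<Union>j\<in>{j\<in>{..<p}. B \<in> e j}. A j)" if "B \<in> Bs" for B
  proof (intro equalityI subsetI)
    fix x assume x: "x \<in> B"
    have "{C \<in> Bs. x \<in> C} \<in> e ` {..<p}" using e by (auto simp: bij_betw_def)
    then obtain j where j: "j < p" "e j = {C \<in> Bs. x \<in> C}" by auto
    then have "x \<in> A j" using x that by (auto simp: A_def)
    then show "x \<in> (\<Union>j\<in>{j\<in>{..<p}. B \<in> e j}. A j)" using j x that by auto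
  qed (use that in \<open>auto simp: A_def\<close>)
  have card_B: "card (S \<inter> B) = (\<Sum>j\<in>{j\<in>{..<p}. B \<in> e j}. card (S \<inter> A j))"
    if "locally_finite n S" "B \<in> Bs" for S B
  proof -
    have "S \<inter> B = (\<Union>j\<in>{j\<in>{..<p}. B \<in> e j}. S \<inter> A j)" by (subst B_eq[OF that(2)]) blast
    also have "card \<dots> = (\<Sum>j\<in>{j\<in>{..<p}. B \<in> e j}. card (S \<inter> A j))"
      using A_disj locally_finite_finite_Int[OF that(1) A_sets]
      by (intro card_UN_disjoint) (auto simp: disjoint_family_on_def)
    finally show ?thesis .
  qed
  \<comment> \<open>Counts in members of \<open>Bs\<close> are sums of atom counts, so the event is
    the preimage of one set of count vectors, the same for both processes.\<close>
  define Z where "Z = {v \<in> space (Pi\<^sub>M {..<p} (\<lambda>_. count_space (UNIV :: nat set))).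
    \<forall>(B, k)\<in>F. (\<Sum>j\<in>{j\<in>{..<p}. B \<in> e j}. v j) = k}"
  have comp: "(\<lambda>v. v j) \<in> measurable (Pi\<^sub>M {..<p} (\<lambda>_. count_space (UNIV :: nat set))) (count_space UNIV)" if "j < p" for j
    using that by (intro measurable_component_singleton) auto
  have "(\<lambda>v. \<Sum>j\<in>J. v j) \<in> measurable (Pi\<^sub>M {..<p} (\<lambda>_. count_space (UNIV :: nat set))) (count_space UNIV)"
    if "J \<subseteq> {..<p}" for J
    using finite_subset[OF that finite_lessThan] that
  proof induction
    case (insert j J)
    then show ?case using comp[of j] by simp measurable
  qed simp
  then have sm: "(\<lambda>v. \<Sum>j\<in>{j\<in>{..<p}. B \<in> e j}. v j) \<in> measurable (Pi\<^sub>M {..<p} (\<lambda>_. count_space (UNIV :: nat set))) (count_space UNIV)" for B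
    by auto
  have Z: "Z \<in> sets (Pi\<^sub>M {..<p} (\<lambda>_. count_space (UNIV :: nat set)))"
  proof -
    have "Measurable.pred (Pi\<^sub>M {..<p} (\<lambda>_. count_space (UNIV :: nat set)))
      (\<lambda>v. \<forall>x\<in>F. (\<Sum>j\<in>{j\<in>{..<p}. fst x \<in> e j}. v j) = snd x)"
      using F(1) by (intro pred_intros_finite pred_eq_const1[OF sm]) auto
    then show ?thesis by (simp add: Z_def pred_def case_prod_unfold)
  qed
  have event: "emeasure M {w \<in> space M. \<forall>(B, k)\<in>F. card (N w \<inter> B) = k}
    = emeasure (distr M (Pi\<^sub>M {..<p} (\<lambda>_. count_space UNIV)) (\<lambda>w. \<lambda>i\<in>{..<p}. card (N w \<inter> A i))) Z"
    if N: "stationary_poisson_process n l M N" for M :: "'x measure" and N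
  proof -
    have m: "(\<lambda>w. \<lambda>i\<in>{..<p}. card (N w \<inter> A i)) \<in> measurable M (Pi\<^sub>M {..<p} (\<lambda>_. count_space UNIV))"
      by (intro measurable_restrict poisson_measurable_card[OF N A_sets])
    have "(\<Sum>j\<in>{j\<in>{..<p}. B \<in> e j}. (\<lambda>i\<in>{..<p}. card (N w \<inter> A i)) j) = card (N w \<inter> B)"
      if "w \<in> space M" "(B, k) \<in> F" for w B k
      using card_B[OF poisson_locally_finite[OF N that(1)], of B] that(2) by (force simp: Bs_def intro!: sum.cong)
    then have "(\<lambda>w. \<lambda>i\<in>{..<p}. card (N w \<inter> A i)) -` Z \<inter> space M = {w \<in> space M. \<forall>(B, k)\<in>F. card (N w \<inter> B) = k}"
      unfolding Z_def by (fastforce simp: space_PiM)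
    then show ?thesis by (simp add: emeasure_distr[OF m Z])
  qed
  show ?thesis
    unfolding event[OF N] event[OF N'] poisson_joint_distr_eq[OF N N' A_sets A_disj \<open>p > 0\<close>] ..
qed

text \<open>Single counting events are not closed under intersection, but finite conjunctions of
  them are, and they generate the same sigma-algebra. Probability measures that agree on such a
  family coincide.\<close>

theorem poisson_law_unique:
  assumes N: "stationary_poisson_process n l M N" and N': "stationary_poisson_process n l M' N'"
  shows "distr M (config_space n) N = distr M' (config_space n) N'"
proof -
  define \<Omega> where "\<Omega> = {S. locally_finite n S}"
  define E where "E = {{S \<in> \<Omega>. \<forall>(B, k)\<in>F. card (S \<inter> B) = k} | F.
     finite F \<and> (\<forall>(B, k)\<in>F. B \<in> bounded_borel n)}"
  interpret M: prob_space M by (rule poisson_processD(2)[OF N])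
  note m = poisson_processD(3)[OF N] poisson_processD(3)[OF N']
  have sets_E: "sigma_sets \<Omega> E = sets (config_space n)"
    unfolding sets_config \<Omega>_def[symmetric]
  proof (rule sigma_sets_eqI)
    fix a assume "a \<in> E"
    then obtain F where F: "a = {S \<in> \<Omega>. \<forall>(B, k)\<in>F. card (S \<inter> B) = k}" "finite F" "\<forall>(B, k)\<in>F. B \<in> bounded_borel n"
      by (auto simp: E_def)
    have "Measurable.pred (config_space n) (\<lambda>S. \<forall>x\<in>F. card (S \<inter> fst x) = snd x)"
      using F by (intro pred_intros_finite pred_eq_const1[OF measurable_card_Int]) auto
    then have "a \<in> sets (config_space n)"
      by (simp add: F(1) pred_def space_config \<Omega>_def case_prod_unfold)
    then show "a \<in> sigma_sets \<Omega> {{S. locally_finite n S \<and> card (S \<inter> B) = k} | B k. B \<in> bounded_borel n}"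
      by (simp add: sets_config \<Omega>_def)
  next
    fix b assume "b \<in> {{S. locally_finite n S \<and> card (S \<inter> B) = k} | B k. B \<in> bounded_borel n}"
    then obtain B k where "b = {S \<in> \<Omega>. \<forall>(B, k)\<in>{(B, k)}. card (S \<inter> B) = k}" "B \<in> bounded_borel n"
      by (auto simp: \<Omega>_def)
    then have "b \<in> E" unfolding E_def by (intro CollectI exI[of _ "{(B, k)}"]) auto
    then show "b \<in> sigma_sets \<Omega> E" by (rule sigma_sets.Basic)
  qed
  show ?thesis
  proof (rule measure_eqI_generator_eq[where E = E and \<Omega> = \<Omega> and A = "\<lambda>_. \<Omega>"])
    show "Int_stable E"
    proof (rule Int_stableI)
      fix a b assume "a \<in> E" "b \<in> E"
      then obtain F G where FG: "a = {S \<in> \<Omega>. \<forall>(B, k)\<in>F. card (S \<inter> B) = k}" "finite F" "\<forall>(B, k)\<in>F. B \<in> bounded_borel n"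
        "b = {S \<in> \<Omega>. \<forall>(B, k)\<in>G. card (S \<inter> B) = k}" "finite G" "\<forall>(B, k)\<in>G. B \<in> bounded_borel n"
        unfolding E_def by blast
      have "a \<inter> b = {S \<in> \<Omega>. \<forall>(B, k)\<in>F \<union> G. card (S \<inter> B) = k}"
        unfolding FG(1,4) ball_Un by (intro set_eqI) (unfold Int_iff mem_Collect_eq, argo)
      moreover have "finite (F \<union> G)" "\<forall>(B, k)\<in>F \<union> G. B \<in> bounded_borel n"
        using FG by (simp_all add: ball_Un)
      ultimately show "a \<inter> b \<in> E" unfolding E_def by blast
    qed
    show "E \<subseteq> Pow \<Omega>" by (auto simp: E_def)
    show "emeasure (distr M (config_space n) N) X = emeasure (distr M' (config_space n) N') X" if XE: "X \<in> E" for X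
    proof -
      from XE obtain F where F: "X = {S \<in> \<Omega>. \<forall>(B, k)\<in>F. card (S \<inter> B) = k}" "finite F" "\<forall>(B, k)\<in>F. B \<in> bounded_borel n"
        unfolding E_def mem_Collect_eq by (elim exE conjE)
      have X: "X \<in> sets (config_space n)" using XE sets_E by (metis sigma_sets.Basic)
      have "N -` X \<inter> space M = {w \<in> space M. \<forall>(B, k)\<in>F. card (N w \<inter> B) = k}"
        "N' -` X \<inter> space M' = {w \<in> space M'. \<forall>(B, k)\<in>F. card (N' w \<inter> B) = k}"
        using poisson_locally_finite[OF N] poisson_locally_finite[OF N'] by (auto simp: F(1) \<Omega>_def)
      moreover have "B \<in> bounded_borel n" if "(B, k) \<in> F" for B k using F(3) that by auto
      ultimately show ?thesis
        using poisson_finite_event_eq[OF N N' F(2)] by (simp add: emeasure_distr m X)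
    qed
    have "\<Omega> \<in> E" unfolding E_def by (intro CollectI exI[of _ "{}"]) auto
    then show "range (\<lambda>_. \<Omega>) \<subseteq> E" by auto
    show "emeasure (distr M (config_space n) N) \<Omega> \<noteq> \<infinity>" for i :: nat
    proof -
      interpret D: prob_space "distr M (config_space n) N" by (rule M.prob_space_distr[OF m(1)])
      show ?thesis by simp
    qed
  qed (auto simp: sets_E)
qed

text \<open>The shifted process has as many points in \<open>B\<close> as the original has in B + t,
  a set of the same volume, and disjoint sets stay disjoint. Uniqueness of the law turns this into
  stationarity.\<close>

lemma poisson_shift:
  assumes N: "stationary_poisson_process n l M N"
  shows "stationary_poisson_process n l M (\<lambda>w. shift n t (N w))"
proof -
  interpret M: prob_space M by (rule poisson_processD(2)[OF N])
  let ?T = "\<lambda>B. {x \<in> space (eucl n). vminus n x t \<in> B}"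
  have c: "card (shift n t (N w) \<inter> B) = card (N w \<inter> ?T B)" if "w \<in> space M" for w B
    using poisson_locally_finite[OF N that] by (intro card_shift_Int) (simp add: locally_finite_def)
  show ?thesis
    unfolding stationary_poisson_process_def
  proof (intro conjI ballI allI impI)
    show "(\<lambda>w. shift n t (N w)) \<in> measurable M (config_space n)"
      using poisson_processD(3)[OF N] measurable_shift by (rule measurable_compose)
    fix B and k :: nat assume B: "B \<in> bounded_borel n"
    have "{w \<in> space M. card (shift n t (N w) \<inter> B) = k} = {w \<in> space M. card (N w \<inter> ?T B) = k}"
      using c by auto
    then show "\<P>(w in M. card (shift n t (N w) \<inter> B) = k)
      = (l * measure (eucl n) B) ^ k / fact k * exp (- (l * measure (eucl n) B))"
      using poisson_processD(4)[OF N translate_bounded_borel[OF B], of t k] B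
      by (simp add: measure_def emeasure_eucl_translate bounded_borel_def)
  next
    fix B :: "nat \<Rightarrow> (nat \<Rightarrow> real) set" and m
    assume B: "(\<forall>i<m. B i \<in> bounded_borel n) \<and> disjoint_family_on B {..<m}"
    have "M.indep_vars (\<lambda>_. count_space UNIV) (\<lambda>i w. card (N w \<inter> ?T (B i))) {..<m}"
      using B by (intro poisson_processD(5)[OF N] translate_bounded_borel) (auto simp: disjoint_family_on_def)
    moreover have "(\<lambda>w. card (shift n t (N w) \<inter> B i)) -` A \<inter> space M
      = (\<lambda>w. card (N w \<inter> ?T (B i))) -` A \<inter> space M" for i A
      using c by auto
    moreover have "(\<lambda>w. card (shift n t (N w) \<inter> B i)) \<in> measurable M (count_space UNIV)
      \<longleftrightarrow> (\<lambda>w. card (N w \<inter> ?T (B i))) \<in> measurable M (count_space UNIV)" for i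
      by (intro measurable_cong c)
    ultimately show "M.indep_vars (\<lambda>_. count_space UNIV) (\<lambda>i w. card (shift n t (N w) \<inter> B i)) {..<m}"
      unfolding M.indep_vars_def2 by simp
  qed (use poisson_processD[OF N] in auto)
qed

corollary poisson_nn_integral_shift:
  assumes N: "stationary_poisson_process n l M N" and f: "f \<in> borel_measurable (config_space n)"
  shows "(\<integral>\<^sup>+w. f (shift n t (N w)) \<partial>M) = (\<integral>\<^sup>+w. f (N w) \<partial>M)"
proof -
  note S = poisson_shift[OF N, of t]
  have "(\<integral>\<^sup>+w. f (shift n t (N w)) \<partial>M) = (\<integral>\<^sup>+S. f S \<partial>distr M (config_space n) (\<lambda>w. shift n t (N w)))"
    using f by (intro nn_integral_distr[symmetric] poisson_processD(3)[OF S]) simp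
  also have "\<dots> = (\<integral>\<^sup>+S. f S \<partial>distr M (config_space n) N)"
    by (simp add: poisson_law_unique[OF S N])
  also have "\<dots> = (\<integral>\<^sup>+w. f (N w) \<partial>M)"
    using f by (intro nn_integral_distr poisson_processD(3)[OF N]) simp
  finally show ?thesis .
qed

subsection \<open>Mass transport and the zero cell\<close>

lemma measure_eucl_ball:
  assumes "n \<ge> 1" "r \<ge> 0"
  shows "measure (eucl n) {x \<in> space (eucl n). enorm n x \<le> r} = unit_ball_vol n * r ^ n"
  using emeasure_eucl_ball[OF assms] assms by (simp add: measure_def)

lemma ball_bounded_borel: "{x \<in> space (eucl n). enorm n x \<le> r} \<in> bounded_borel n"
  using cball_bounded_borel[OF origin_in_space, of n r] by simp

lemma poisson_hit_prob:
  assumes N: "stationary_poisson_process n l M N" and "n \<ge> 1" "r \<ge> 0"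
  shows "measure M {w \<in> space M. hit n (origin n) r (N w)} = 1 - exp (- (l * (unit_ball_vol n * r ^ n)))"
proof -
  interpret M: prob_space M by (rule poisson_processD(2)[OF N])
  let ?B = "{x \<in> space (eucl n). enorm n x \<le> r}"
  let ?E = "{w \<in> space M. card (N w \<inter> ?B) = 0}"
  have E: "?E \<in> M.events"
  proof -
    note [measurable] = poisson_measurable_card[OF N ball_bounded_borel]
    show ?thesis by measurable
  qed
  have "{w \<in> space M. hit n (origin n) r (N w)} = space M - ?E"
    using hit_iff_card[OF poisson_locally_finite[OF N] origin_in_space, of _ r] by auto
  then show ?thesis
    using M.prob_compl[OF E] poisson_processD(4)[OF N ball_bounded_borel, of r 0] assms
    by (simp add: measure_eucl_ball)
qed

text \<open>An empty configuration misses the ball of every radius \<open>k\<close>, and the void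
  probabilities decay at least like \<open>exp (- c * real k)\<close> because \<open>k\<close> is at
  most its n-th power. In dimension 0 the space is a single point, which the process may
  miss.\<close>

lemma poisson_nonempty:
  assumes N: "stationary_poisson_process n l M N" and "n \<ge> 1"
  shows "AE w in M. N w \<noteq> {}"
proof -
  interpret M: prob_space M by (rule poisson_processD(2)[OF N])
  note [measurable] = poisson_processD(3)[OF N]
  define E where "E = {w \<in> space M. \<forall>k::nat. \<not> hit n (origin n) (real k) (N w)}"
  have E [measurable]: "E \<in> M.events" unfolding E_def by measurable
  define c where "c = l * unit_ball_vol n"
  have c: "c > 0" using poisson_processD(1)[OF N] by (simp add: c_def)
  have le: "M.prob E \<le> exp (- c * real k)" for k
  proof -
    have H [measurable]: "{w \<in> space M. hit n (origin n) (real k) (N w)} \<in> M.events" by measurable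
    have "M.prob E \<le> M.prob (space M - {w \<in> space M. hit n (origin n) (real k) (N w)})"
      by (intro M.finite_measure_mono) (auto simp: E_def)
    also have "\<dots> = exp (- (l * (unit_ball_vol n * real k ^ n)))"
      using poisson_hit_prob[OF N \<open>n \<ge> 1\<close>, of "real k"] M.prob_compl[OF H] by simp
    also have "\<dots> \<le> exp (- c * real k)"
    proof -
      have "real k \<le> real k ^ n" using \<open>n \<ge> 1\<close> by (cases "k = 0") (auto intro!: self_le_power)
      then have "c * real k \<le> c * real k ^ n" using c by simp
      then show ?thesis by (simp add: c_def mult.assoc)
    qed
    finally show ?thesis .
  qed
  have "(\<lambda>k. exp (- c * real k)) \<longlonglongrightarrow> 0" using c by real_asymp
  then have "M.prob E \<le> 0" by (rule LIMSEQ_le_const) (use le in auto)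
  then have "emeasure M E = 0" by (simp add: M.emeasure_eq_measure antisym)
  then show ?thesis
    by (intro AE_I[OF _ _ E]) (auto simp: E_def hit_def)
qed

text \<open>The bound follows from \<open>exp (- m) \<ge> 1 - m\<close>. Being of second order in
  the volume is the point: summed over many small cells of fixed total volume it tends to 0.\<close>

lemma poisson_two_points_prob:
  assumes N: "stationary_poisson_process n l M N" and B: "B \<in> bounded_borel n"
  shows "measure M {w \<in> space M. 2 \<le> card (N w \<inter> B)} \<le> (l * measure (eucl n) B)\<^sup>2"
proof -
  interpret M: prob_space M by (rule poisson_processD(2)[OF N])
  note [measurable] = poisson_measurable_card[OF N B]
  define m where "m = l * measure (eucl n) B"
  have "m \<ge> 0" using poisson_processD(1)[OF N] by (simp add: m_def)
  let ?E = "\<lambda>k. {w \<in> space M. card (N w \<inter> B) = k}"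
  have "M.prob (?E 0 \<union> ?E 1) = M.prob (?E 0) + M.prob (?E 1)"
    by (intro M.finite_measure_Union) auto
  also have "\<dots> = exp (- m) + m * exp (- m)"
    using poisson_processD(4)[OF N B, of 0] poisson_processD(4)[OF N B, of 1] by (simp add: m_def)
  finally have p: "M.prob (?E 0 \<union> ?E 1) = (1 + m) * exp (- m)" by (simp add: algebra_simps)
  have "{w \<in> space M. 2 \<le> card (N w \<inter> B)} = space M - (?E 0 \<union> ?E 1)" by auto
  then have "M.prob {w \<in> space M. 2 \<le> card (N w \<inter> B)} = 1 - (1 + m) * exp (- m)"
    using p M.prob_compl[of "?E 0 \<union> ?E 1"] by simp
  also have "\<dots> \<le> 1 - (1 + m) * (1 - m)"
    using exp_ge_add_one_self[of "- m"] \<open>m \<ge> 0\<close> by (intro diff_left_mono mult_left_mono) auto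
  also have "\<dots> = m\<^sup>2" by (simp add: algebra_simps power2_eq_square)
  finally show ?thesis by (simp add: m_def)
qed

text \<open>The ball of radius \<open>R\<close> is cut into \<open>m\<close> shells of equal volume. A tie puts two points into
  one of them, which has probability \<open>O(1 / m)\<close>.\<close>

lemma poisson_no_ties:
  assumes N: "stationary_poisson_process n l M N" and "n \<ge> 1"
  shows "AE w in M. \<forall>x\<in>N w. \<forall>y\<in>N w. enorm n x = enorm n y \<longrightarrow> x = y"
proof -
  interpret M: prob_space M by (rule poisson_processD(2)[OF N])
  \<comment> \<open>The n-th power of the norm is proportional to the volume of the ball, so cutting
    its range evenly gives shells of equal volume.\<close>
  define shell where "shell R m j = {x \<in> space (eucl n). real j < real m * (enorm n x / R) ^ n
     \<and> real m * (enorm n x / R) ^ n \<le> real (Suc j)}" for R :: real and m j :: nat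
  define V where "V R = unit_ball_vol n * R ^ n" for R :: real
  have sub: "{x \<in> space (eucl n). real m * (enorm n x / R) ^ n \<le> real j}
      = {x \<in> space (eucl n). enorm n x \<le> R * root n (real j / real m)}" if "R > 0" "m > 0" for R m j
  proof -
    have "real m * (enorm n x / R) ^ n \<le> real j \<longleftrightarrow> enorm n x \<le> R * root n (real j / real m)" for x
    proof -
      have "real m * (enorm n x / R) ^ n \<le> real j \<longleftrightarrow> (enorm n x / R) ^ n \<le> real j / real m"
        using that by (simp add: field_simps)
      also have "\<dots> \<longleftrightarrow> (enorm n x / R) ^ n \<le> root n (real j / real m) ^ n"
        using \<open>n \<ge> 1\<close> by simp
      also have "\<dots> \<longleftrightarrow> enorm n x / R \<le> root n (real j / real m)"
        using \<open>n \<ge> 1\<close> that by (intro power_mono_iff) auto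
      also have "\<dots> \<longleftrightarrow> enorm n x \<le> R * root n (real j / real m)"
        using that by (simp add: field_simps)
      finally show ?thesis .
    qed
    then show ?thesis by simp
  qed
  have vol: "measure (eucl n) {x \<in> space (eucl n). real m * (enorm n x / R) ^ n \<le> real j} = V R * real j / real m"
    if "R > 0" "m > 0" for R m j
    unfolding sub[OF that] using that \<open>n \<ge> 1\<close>
    by (subst measure_eucl_ball) (auto simp: V_def power_mult_distrib)
  have shell: "shell R m j \<in> bounded_borel n" "measure (eucl n) (shell R m j) = V R / real m"
    if "R > 0" "m > 0" for R m j
  proof -
    let ?U = "\<lambda>j. {x \<in> space (eucl n). real m * (enorm n x / R) ^ n \<le> real j}"
    have U: "?U j \<in> bounded_borel n" for j
      unfolding sub[OF that] by (rule ball_bounded_borel)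
    have eq: "shell R m j = ?U (Suc j) - ?U j" by (auto simp: shell_def)
    show "shell R m j \<in> bounded_borel n"
      using U[of j] U[of "Suc j"] unfolding eq bounded_borel_def by blast
    have "measure (eucl n) (?U (Suc j) - ?U j) = measure (eucl n) (?U (Suc j)) - measure (eucl n) (?U j)"
    proof (rule measure_Diff)
      show "emeasure (eucl n) (?U (Suc j)) \<noteq> \<infinity>"
        unfolding sub[OF that] using that \<open>n \<ge> 1\<close> by (subst emeasure_eucl_ball) auto
    qed (use U in \<open>auto simp: bounded_borel_def\<close>)
    also have "\<dots> = V R / real m"
      unfolding vol[OF that] by (simp add: field_simps add_divide_distrib)
    finally show "measure (eucl n) (shell R m j) = V R / real m" by (simp add: eq)
  qed
  define E where "E R m = (\<Union>j<m. {w \<in> space M. 2 \<le> card (N w \<inter> shell R m j)})" for R m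
  have E_sets: "E R m \<in> M.events" if "R > 0" "m > 0" for R m
  proof -
    note [measurable] = poisson_measurable_card[OF N shell(1)[OF that]]
    show ?thesis unfolding E_def by measurable
  qed
  have E_prob: "M.prob (E R m) \<le> (l * V R)\<^sup>2 / real m" if "R > 0" "m > 0" for R m
  proof -
    note [measurable] = poisson_measurable_card[OF N shell(1)[OF that]]
    have "M.prob (E R m) \<le> (\<Sum>j<m. M.prob {w \<in> space M. 2 \<le> card (N w \<inter> shell R m j)})"
      unfolding E_def by (intro M.finite_measure_subadditive_finite) auto
    also have "\<dots> \<le> (\<Sum>j<m. (l * (V R / real m))\<^sup>2)"
      using poisson_two_points_prob[OF N shell(1)[OF that]] by (intro sum_mono) (simp add: shell(2)[OF that])
    also have "\<dots> = (l * V R)\<^sup>2 / real m"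
      using that by (simp add: power2_eq_square)
    finally show ?thesis .
  qed
  \<comment> \<open>The events need not decrease in \<open>m\<close>; it suffices that their
    intersection is null. \<open>Suc\<close> keeps the number of shells positive.\<close>
  have "AE w in M. \<exists>m. w \<notin> E R (Suc m)" if "R > 0" for R
  proof -
    have "M.prob (\<Inter>m. E R (Suc m)) \<le> (l * V R)\<^sup>2 / real (Suc m)" for m
    proof -
      have "M.prob (\<Inter>m. E R (Suc m)) \<le> M.prob (E R (Suc m))"
        using E_sets[OF that] by (intro M.finite_measure_mono) auto
      also have "\<dots> \<le> (l * V R)\<^sup>2 / real (Suc m)" using that by (intro E_prob) auto
      finally show ?thesis .
    qed
    moreover have "(\<lambda>m. (l * V R)\<^sup>2 / real (Suc m)) \<longlonglongrightarrow> 0"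
      by (intro LIMSEQ_Suc[OF lim_const_over_n])
    ultimately have "M.prob (\<Inter>m. E R (Suc m)) \<le> 0"
      by (intro LIMSEQ_le_const[of "\<lambda>m. (l * V R)\<^sup>2 / real (Suc m)"]) auto
    then have "emeasure M (\<Inter>m. E R (Suc m)) = 0" by (simp add: M.emeasure_eq_measure antisym)
    then show ?thesis
      using E_sets that by (intro AE_I[where N = "\<Inter>m. E R (Suc m)"]) auto
  qed
  then have "AE w in M. \<forall>K::nat. \<exists>m. w \<notin> E (real (Suc K)) (Suc m)"
    by (subst AE_all_countable) simp
  then show ?thesis
  proof (rule AE_mp, intro AE_I2 impI ballI)
    fix w x y
    assume w: "w \<in> space M" "\<forall>K::nat. \<exists>m. w \<notin> E (real (Suc K)) (Suc m)"
      and xy: "x \<in> N w" "y \<in> N w" "enorm n x = enorm n y"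
    have lf: "locally_finite n (N w)" by (rule poisson_locally_finite[OF N w(1)])
    then have sp: "x \<in> space (eucl n)" "y \<in> space (eucl n)"
      using xy by (auto simp: locally_finite_def)
    obtain K :: nat where K: "enorm n x \<le> real K" using real_arch_simple by blast
    define R where "R = real (Suc K)"
    have "R > 0" by (simp add: R_def)
    obtain m where m: "w \<notin> E R (Suc m)" using w(2) by (auto simp: R_def)
    define u where "u = real (Suc m) * (enorm n x / R) ^ n"
    have "enorm n x / R \<le> 1" using K \<open>R > 0\<close> by (simp add: R_def)
    then have "(enorm n x / R) ^ n \<le> 1" using \<open>R > 0\<close> by (intro power_le_one) auto
    then have "u \<le> real (Suc m)"
      unfolding u_def using mult_left_mono[of "(enorm n x / R) ^ n" 1 "real (Suc m)"] by simp
    show "x = y"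
    \<comment> \<open>Shells exclude their inner boundary, so the origin lies in none of them; but
      it is the only point of norm 0.\<close>
    proof (cases "u = 0")
      case True
      then have "enorm n x = 0" using \<open>R > 0\<close> \<open>n \<ge> 1\<close> by (simp add: u_def)
      then show ?thesis
        using pdist_eq_0[OF sp(1) origin_in_space] pdist_eq_0[OF sp(2) origin_in_space] xy(3) by simp
    next
      case False
      have "u \<ge> 0" using \<open>R > 0\<close> by (simp add: u_def)
      with False have "u > 0" by simp
      \<comment> \<open>Ceiling minus one, since \<open>u\<close> must exceed \<open>j\<close>
        strictly and may equal \<open>j + 1\<close>.\<close>
      define j where "j = nat (\<lceil>u\<rceil> - 1)"
      have j: "real j < u" "u \<le> real (Suc j)" using \<open>u > 0\<close> by (auto simp: j_def) linarith+
      then have "j < Suc m" using \<open>u \<le> real (Suc m)\<close> by linarith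
      then have c: "card (N w \<inter> shell R (Suc m) j) < 2" using m w(1) by (force simp: E_def not_le)
      have fin: "finite (N w \<inter> shell R (Suc m) j)"
        by (rule locally_finite_finite_Int[OF lf shell(1)[OF \<open>R > 0\<close>]]) simp
      have "x \<in> N w \<inter> shell R (Suc m) j" "y \<in> N w \<inter> shell R (Suc m) j"
        using j xy sp by (auto simp: shell_def u_def)
      then show ?thesis
        using c fin card_le_Suc0_iff_eq[OF fin] by auto
    qed
  qed
qed

section \<open>The zero cell and its center\<close>

lemma locally_finite_nearest_exists:
  assumes "locally_finite n S" "S \<noteq> {}"
  shows "\<exists>c\<in>S. nearest n S (origin n) c"
proof -
  obtain y where y: "y \<in> S" using assms(2) by auto
  let ?F = "{x \<in> S. enorm n x \<le> enorm n y}"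
  have F: "finite ?F" "?F \<noteq> {}" using assms(1) y by (auto simp: locally_finite_def)
  define c where "c = arg_min_on (enorm n) ?F"
  have c: "c \<in> ?F" unfolding c_def by (rule arg_min_if_finite(1)[OF F])
  have least: "enorm n c \<le> enorm n x" if "x \<in> ?F" for x
    unfolding c_def by (rule arg_min_least[OF F that])
  have "enorm n c \<le> enorm n x" if "x \<in> S" for x
    using c least[of x] that by (cases "enorm n x \<le> enorm n y") auto
  then have "nearest n S (origin n) c" by (simp add: nearest_def)
  then show ?thesis using c by auto
qed

lemma voronoi_cell_nearest: "voronoi_cell n S x = {z \<in> space (eucl n). nearest n S z x}"
  by (simp add: voronoi_cell_def nearest_def pdist_def)

text \<open>A cell contains the origin exactly when its center is nearest to the origin, so
  uniqueness of the nearest point resolves the first description operator. For the second, a center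
  lies in its own cell: if two cells are equal, each center is at distance 0 from the other.\<close>

lemma zero_cell_eq:
  assumes S: "S \<subseteq> space (eucl n)" and c: "c \<in> S" "nearest n S (origin n) c"
    and uniq: "\<And>x. x \<in> S \<Longrightarrow> nearest n S (origin n) x \<Longrightarrow> x = c"
  shows "zero_cell n S = voronoi_cell n S c" "center n S (zero_cell n S) = c"
proof -
  show z: "zero_cell n S = voronoi_cell n S c"
    unfolding zero_cell_def
  proof (rule the_equality)
    show "voronoi_cell n S c \<in> voronoi_mosaic n S \<and> origin n \<in> voronoi_cell n S c"
      using c by (simp add: voronoi_mosaic_def voronoi_cell_nearest)
    fix C assume "C \<in> voronoi_mosaic n S \<and> origin n \<in> C"
    then obtain x where "x \<in> S" "C = voronoi_cell n S x" "nearest n S (origin n) x"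
      unfolding voronoi_mosaic_def voronoi_cell_nearest by blast
    then show "C = voronoi_cell n S c" using uniq by blast
  qed
  show "center n S (zero_cell n S) = c"
    unfolding z center_def
  proof (rule the_equality)
    fix x assume x: "x \<in> S \<and> voronoi_cell n S x = voronoi_cell n S c"
    have "x \<in> voronoi_cell n S x" using x S by (auto simp: voronoi_cell_nearest nearest_def)
    then have "nearest n S x c" using x by (auto simp: voronoi_cell_nearest)
    then have "pdist n x c \<le> 0" using x by (auto simp: nearest_def dest: bspec[of _ _ x])
    then show "x = c" using x c S by (intro pdist_eq_0[of _ n]) (auto simp: antisym)
  qed (use c in auto)
qed

text \<open>Equals the volume of the zero cell when \<open>t\<close> lies in it and the nearest
  point to the origin is unique. Integrating the relation makes measurability in \<open>t\<close>
  and \<open>S\<close> immediate.\<close>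

definition joint_volume :: "nat \<Rightarrow> (nat \<Rightarrow> real) \<Rightarrow> (nat \<Rightarrow> real) set \<Rightarrow> ennreal" where
  "joint_volume n t S = (\<integral>\<^sup>+u. of_bool (same_cell n S (origin n) t u) \<partial>eucl n)"

text \<open>If the origin and \<open>t\<close> share a cell of volume \<open>v\<close> with centre \<open>x\<close>, the origin sends mass
  with density \<open>1 / v\<close> to \<open>t\<close> provided that \<open>t\<close> is within distance \<open>r\<close> of \<open>x\<close>; the functions below
  are the mass sent by the origin to \<open>t\<close> and the mass received by the origin from \<open>t\<close>.\<close>

definition mass_out :: "nat \<Rightarrow> real \<Rightarrow> (nat \<Rightarrow> real) \<Rightarrow> (nat \<Rightarrow> real) set \<Rightarrow> ennreal" where
  "mass_out n r t S = of_bool (same_cell n S (origin n) t t \<and> hit n t r S) / joint_volume n t S"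

definition mass_in :: "nat \<Rightarrow> real \<Rightarrow> (nat \<Rightarrow> real) \<Rightarrow> (nat \<Rightarrow> real) set \<Rightarrow> ennreal" where
  "mass_in n r t S = of_bool (same_cell n S (origin n) t t \<and> hit n (origin n) r S) / joint_volume n t S"

lemma measurable_of_bool_ennreal:
  assumes "Measurable.pred M P"
  shows "(\<lambda>x. of_bool (P x) :: ennreal) \<in> borel_measurable M"
proof -
  have "(\<lambda>x. of_bool (P x) :: ennreal) = (\<lambda>x. if P x then 1 else 0)" by (auto simp: of_bool_def)
  then show ?thesis using assms by simp
qed

lemma measurable_joint_volume [measurable]:
  assumes [measurable]: "f \<in> measurable M (eucl n)" "F \<in> measurable M (config_space n)"
  shows "(\<lambda>x. joint_volume n (f x) (F x)) \<in> borel_measurable M"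
proof -
  interpret sigma_finite_measure "eucl n" by (rule sigma_finite_eucl)
  have "(\<lambda>(x, u). of_bool (same_cell n (F x) (origin n) (f x) u) :: ennreal) \<in> borel_measurable (M \<Otimes>\<^sub>M eucl n)"
    unfolding case_prod_unfold by (intro measurable_of_bool_ennreal pred_same_cell) measurable
  then show ?thesis
    unfolding joint_volume_def by (rule borel_measurable_nn_integral)
qed

lemma measurable_mass [measurable]:
  assumes [measurable]: "f \<in> measurable M (eucl n)" "F \<in> measurable M (config_space n)"
  shows "(\<lambda>x. mass_out n r (f x) (F x)) \<in> borel_measurable M"
    "(\<lambda>x. mass_in n r (f x) (F x)) \<in> borel_measurable M"
proof -
  have [measurable]: "(\<lambda>x. of_bool (same_cell n (F x) (origin n) (f x) (f x) \<and> hit n (f x) r (F x)) :: ennreal) \<in> borel_measurable M"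
    "(\<lambda>x. of_bool (same_cell n (F x) (origin n) (f x) (f x) \<and> hit n (origin n) r (F x)) :: ennreal) \<in> borel_measurable M"
    by (intro measurable_of_bool_ennreal pred_intros_logic pred_same_cell pred_hit; measurable)+
  show "(\<lambda>x. mass_out n r (f x) (F x)) \<in> borel_measurable M"
    "(\<lambda>x. mass_in n r (f x) (F x)) \<in> borel_measurable M"
    unfolding mass_out_def mass_in_def by measurable
qed

text \<open>Translation by -t exchanges the roles: \<open>t\<close> becomes the origin and the
  origin becomes -t. What the origin sends to \<open>t\<close> is thus what the origin receives from
  -t in the shifted configuration.\<close>

lemma mass_shift:
  assumes t: "t \<in> space (eucl n)" and S: "locally_finite n S"
  shows "mass_in n r (vminus n (origin n) t) (shift n t S) = mass_out n r t S"
proof -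
  have S': "S \<in> space (config_space n)" using S by (simp add: space_config)
  have sc: "same_cell n (shift n t S) (origin n) (vminus n (origin n) t) (vminus n u t) = same_cell n S (origin n) t u" for u
    using same_cell_shift[of n t S t "origin n" u] by (simp add: same_cell_commute)
  have "joint_volume n (vminus n (origin n) t) (shift n t S) =
    (\<integral>\<^sup>+u. of_bool (same_cell n (shift n t S) (origin n) (vminus n (origin n) t) (vminus n u t)) \<partial>eucl n)"
    unfolding joint_volume_def
    using S' measurable_space[OF measurable_shift S']
    by (intro nn_integral_eucl_translate[symmetric] measurable_of_bool_ennreal pred_same_cell) auto
  then have jv: "joint_volume n (vminus n (origin n) t) (shift n t S) = joint_volume n t S"
    by (simp add: sc joint_volume_def)
  have "hit n (origin n) r (shift n t S) = hit n t r S"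
    using hit_shift[of n t t r S] by simp
  moreover have "same_cell n (shift n t S) (origin n) (vminus n (origin n) t) (vminus n (origin n) t) = same_cell n S (origin n) t t"
    unfolding sc by (auto simp: same_cell_def)
  ultimately show ?thesis by (simp add: mass_in_def mass_out_def jv)
qed

text \<open>After Fubini, \<open>t\<close> is fixed while the configuration is averaged, so
  stationarity removes a shift by \<open>t\<close>; the remaining sign of \<open>t\<close> is
  absorbed by reflecting the Lebesgue integral.\<close>

theorem mass_transport:
  assumes N: "stationary_poisson_process n l M N"
  shows "(\<integral>\<^sup>+w. \<integral>\<^sup>+t. mass_out n r t (N w) \<partial>eucl n \<partial>M) = (\<integral>\<^sup>+w. \<integral>\<^sup>+t. mass_in n r t (N w) \<partial>eucl n \<partial>M)"
proof -
  interpret M: prob_space M by (rule poisson_processD(2)[OF N])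
  interpret E: sigma_finite_measure "eucl n" by (rule sigma_finite_eucl)
  interpret P: pair_sigma_finite "eucl n" M ..
  note [measurable] = poisson_processD(3)[OF N]
  have "(\<integral>\<^sup>+w. \<integral>\<^sup>+t. mass_out n r t (N w) \<partial>eucl n \<partial>M) = (\<integral>\<^sup>+t. \<integral>\<^sup>+w. mass_out n r t (N w) \<partial>M \<partial>eucl n)"
    by (rule P.Fubini') measurable
  also have "\<dots> = (\<integral>\<^sup>+t. \<integral>\<^sup>+w. mass_in n r (vminus n (origin n) t) (shift n t (N w)) \<partial>M \<partial>eucl n)"
    by (intro nn_integral_cong mass_shift[symmetric] poisson_locally_finite[OF N])
  also have "\<dots> = (\<integral>\<^sup>+t. \<integral>\<^sup>+w. mass_in n r (vminus n (origin n) t) (N w) \<partial>M \<partial>eucl n)"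
    by (intro nn_integral_cong poisson_nn_integral_shift[OF N] measurable_mass) auto
  also have "\<dots> = (\<integral>\<^sup>+t. \<integral>\<^sup>+w. mass_in n r t (N w) \<partial>M \<partial>eucl n)"
    by (rule nn_integral_eucl_reflect) measurable
  also have "\<dots> = (\<integral>\<^sup>+w. \<integral>\<^sup>+t. mass_in n r t (N w) \<partial>eucl n \<partial>M)"
    by (rule P.Fubini'[symmetric]) measurable
  finally show ?thesis .
qed

text \<open>Without ties the origin has one nearest point \<open>c\<close>, so sharing a cell with
  the origin means lying in the cell of \<open>c\<close>. The quotient of the volume by itself stays
  unsimplified: in the extended reals it is 1 only for positive finite volume, which is not known
  here.\<close>

lemma zero_cell_mass:
  assumes S: "locally_finite n S" and ne: "S \<noteq> {}"
    and no_ties: "\<And>x y. x \<in> S \<Longrightarrow> y \<in> S \<Longrightarrow> enorm n x = enorm n y \<Longrightarrow> x = y"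
  defines "D \<equiv> centered_zero_cell n S"
  shows "D \<in> sets (eucl n)"
    and "(\<integral>\<^sup>+t. mass_out n r t S \<partial>eucl n) = emeasure (eucl n) (D \<inter> {x \<in> space (eucl n). enorm n x \<le> r}) / emeasure (eucl n) D"
    and "(\<integral>\<^sup>+t. mass_in n r t S \<partial>eucl n) = of_bool (hit n (origin n) r S) * (emeasure (eucl n) D / emeasure (eucl n) D)"
proof -
  obtain c where c: "c \<in> S" "nearest n S (origin n) c"
    using locally_finite_nearest_exists[OF S ne] by auto
  have sp: "S \<subseteq> space (eucl n)" using S by (simp add: locally_finite_def)
  have Sc: "S \<in> space (config_space n)" using S by (simp add: space_config)
  have uniq: "x = c" if "x \<in> S" "nearest n S (origin n) x" for x
    using that c no_ties[of x c] by (force simp: nearest_def)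
  define V where "V = voronoi_cell n S c"
  \<comment> \<open>This is -c: the cell moved by -c is the preimage of \<open>V\<close> under the
    translation by \<open>c\<close>.\<close>
  define c' where "c' = vminus n (origin n) c"
  have same: "same_cell n S (origin n) t u \<longleftrightarrow> nearest n S t c \<and> nearest n S u c" for t u
    unfolding same_cell_def using c uniq by blast
  have V_eq: "V = {z \<in> space (eucl n). same_cell n S (origin n) z z}"
    by (auto simp: V_def voronoi_cell_nearest same)
  have V: "V \<in> sets (eucl n)"
    unfolding V_eq using Sc by (intro predE pred_same_cell) auto
  have D_eq: "D = {z \<in> space (eucl n). vminus n z c' \<in> V}"
  proof -
    have "D = (\<lambda>z. vminus n z c) ` V"
      using zero_cell_eq[OF sp c] uniq by (simp add: D_def centered_zero_cell_def V_def)
    also have "\<dots> = {z \<in> space (eucl n). vminus n z c' \<in> V}"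
    proof (intro equalityI subsetI)
      fix z assume "z \<in> {z \<in> space (eucl n). vminus n z c' \<in> V}"
      then show "z \<in> (\<lambda>z. vminus n z c) ` V"
        by (intro image_eqI[of _ _ "vminus n z c'"]) (auto simp: c'_def)
    qed (auto simp: c'_def V_eq)
    finally show ?thesis .
  qed
  have "(\<lambda>z. vminus n z c') -` V \<inter> space (eucl n) \<in> sets (eucl n)"
    using V by (rule measurable_sets[OF measurable_vminus_right])
  moreover have "(\<lambda>z. vminus n z c') -` V \<inter> space (eucl n) = D" by (auto simp: D_eq)
  ultimately show D: "D \<in> sets (eucl n)" by simp
  have vol: "emeasure (eucl n) D = emeasure (eucl n) V"
    unfolding D_eq by (rule emeasure_eucl_translate[OF V])
  have jv: "joint_volume n t S = emeasure (eucl n) V" if "t \<in> V" for t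
  proof -
    have "joint_volume n t S = (\<integral>\<^sup>+u. indicator V u \<partial>eucl n)"
      unfolding joint_volume_def using that
      by (intro nn_integral_cong) (auto simp: same V_def voronoi_cell_nearest indicator_def)
    then show ?thesis using V by simp
  qed
  let ?B = "{t \<in> space (eucl n). pdist n t c \<le> r}"
  have B: "?B \<in> sets (eucl n)"
  proof -
    have "(\<lambda>t. pdist n t c) \<in> borel_measurable (eucl n)" using c sp by (intro measurable_pdist) auto
    then show ?thesis by measurable
  qed
  \<comment> \<open>Inside the cell \<open>c\<close> is a nearest point, so a ball around
    \<open>t\<close> is hit exactly when it contains \<open>c\<close>.\<close>
  have hit: "hit n t r S \<longleftrightarrow> pdist n t c \<le> r" if "t \<in> V" for t
    using that c(1) by (force simp: hit_def V_def voronoi_cell_nearest nearest_def)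
  have "(\<integral>\<^sup>+t. mass_out n r t S \<partial>eucl n) = (\<integral>\<^sup>+t. indicator (V \<inter> ?B) t / emeasure (eucl n) V \<partial>eucl n)"
  proof (rule nn_integral_cong)
    fix t assume t: "t \<in> space (eucl n)"
    show "mass_out n r t S = indicator (V \<inter> ?B) t / emeasure (eucl n) V"
    proof (cases "t \<in> V")
      case True
      then show ?thesis
        using t hit[OF True] by (auto simp: mass_out_def jv V_eq indicator_def)
    \<comment> \<open>Outside \<open>V\<close> the numerator is 0, and 0 divided by anything, 0
      included, is 0 in \<open>ennreal\<close>.\<close>
    qed (use t in \<open>auto simp: mass_out_def V_eq\<close>)
  qed
  also have "\<dots> = emeasure (eucl n) (V \<inter> ?B) / emeasure (eucl n) V"
    using V B by (subst nn_integral_divide) auto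
  also have "emeasure (eucl n) (V \<inter> ?B) = emeasure (eucl n) {z \<in> space (eucl n). vminus n z c' \<in> V \<inter> ?B}"
    using V B by (intro emeasure_eucl_translate[symmetric]) auto
  also have "{z \<in> space (eucl n). vminus n z c' \<in> V \<inter> ?B} = D \<inter> {x \<in> space (eucl n). enorm n x \<le> r}"
  proof -
    have "pdist n (vminus n z c') c = enorm n z" if "z \<in> space (eucl n)" for z
      using pdist_vminus_right[of n "vminus n z c'" c c] that by (simp add: c'_def)
    then show ?thesis by (auto simp: D_eq)
  qed
  finally show "(\<integral>\<^sup>+t. mass_out n r t S \<partial>eucl n) = emeasure (eucl n) (D \<inter> {x \<in> space (eucl n). enorm n x \<le> r}) / emeasure (eucl n) D"
    by (simp add: vol)
  have "(\<integral>\<^sup>+t. mass_in n r t S \<partial>eucl n) = (\<integral>\<^sup>+t. of_bool (hit n (origin n) r S) * (indicator V t / emeasure (eucl n) V) \<partial>eucl n)"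
  proof (rule nn_integral_cong)
    fix t assume t: "t \<in> space (eucl n)"
    show "mass_in n r t S = of_bool (hit n (origin n) r S) * (indicator V t / emeasure (eucl n) V)"
    proof (cases "t \<in> V")
      case True
      then show ?thesis by (auto simp: mass_in_def jv V_eq indicator_def)
    qed (use t in \<open>auto simp: mass_in_def V_eq\<close>)
  qed
  also have "\<dots> = of_bool (hit n (origin n) r S) * (emeasure (eucl n) V / emeasure (eucl n) V)"
    using V by (simp add: nn_integral_cmult nn_integral_divide)
  finally show "(\<integral>\<^sup>+t. mass_in n r t S \<partial>eucl n) = of_bool (hit n (origin n) r S) * (emeasure (eucl n) D / emeasure (eucl n) D)"
    by (simp add: vol)
qed

text \<open>Averaging a conditional probability gives the probability. The second claim takes the
  sure event, whose conditional probability is 1; it is the source of the positive finite volume of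
  the zero cell.\<close>

lemma cond_uniform_on_prob:
  assumes M: "prob_space M" and N: "N \<in> measurable M (config_space n)"
    and Y: "cond_uniform_on n M N Y D" and A: "A \<in> sets (eucl n)"
  shows "(\<integral>\<^sup>+w. ennreal (measure (uniform_measure (eucl n) (D (N w))) A) \<partial>M) = emeasure M {w \<in> space M. Y w \<in> A}"
    and "AE w in M. measure (uniform_measure (eucl n) (D (N w))) (space (eucl n)) = 1"
proof -
  interpret M: prob_space M by fact
  define F where "F = vimage_algebra (space M) N (config_space n)"
  have "N \<in> space M \<rightarrow> space (config_space n)" using measurable_space[OF N] by auto
  then have F: "space F = space M" "sets F \<subseteq> sets M"
    using N by (auto simp: F_def sets_vimage_algebra2 intro: measurable_sets)
  interpret finite_measure_subalgebra M F
    by unfold_locales (simp add: subalgebra_def F)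
  have Ym: "Y \<in> measurable M (eucl n)"
    and Yc: "\<And>A. A \<in> sets (eucl n) \<Longrightarrow> AE w in M. real_cond_exp M F (indicat_real (Y -` A \<inter> space M)) w
        = measure (uniform_measure (eucl n) (D (N w))) A"
    using Y by (auto simp: cond_uniform_on_def F_def)
  have YA: "Y -` A \<inter> space M \<in> sets M" by (rule measurable_sets[OF Ym A])
  let ?f = "indicat_real (Y -` A \<inter> space M)"
  have int: "integrable M ?f" using YA by (simp add: M.emeasure_eq_measure)
  have "(\<integral>\<^sup>+w. ennreal (measure (uniform_measure (eucl n) (D (N w))) A) \<partial>M) = (\<integral>\<^sup>+w. ennreal (real_cond_exp M F ?f w) \<partial>M)"
    using Yc[OF A] by (intro nn_integral_cong_AE) auto
  also have "\<dots> = ennreal (\<integral>w. real_cond_exp M F ?f w \<partial>M)"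
    using int YA by (intro nn_integral_eq_integral real_cond_exp_int real_cond_exp_pos) auto
  also have "(\<integral>w. real_cond_exp M F ?f w \<partial>M) = (\<integral>w. ?f w \<partial>M)"
    by (rule real_cond_exp_int(2)[OF int])
  also have "ennreal \<dots> = emeasure M (Y -` A \<inter> space M)"
    using YA by (simp add: M.emeasure_eq_measure)
  also have "Y -` A \<inter> space M = {w \<in> space M. Y w \<in> A}" by auto
  finally show "(\<integral>\<^sup>+w. ennreal (measure (uniform_measure (eucl n) (D (N w))) A) \<partial>M) = emeasure M {w \<in> space M. Y w \<in> A}" .
  have sp: "Y -` space (eucl n) \<inter> space M = space M" using measurable_space[OF Ym] by auto
  have "AE w in M. real_cond_exp M F (indicat_real (space M)) w = indicat_real (space M) w"
  proof (rule real_cond_exp_F_meas)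
    show "integrable M (indicat_real (space M))" by (simp add: M.emeasure_eq_measure)
    show "indicat_real (space M) \<in> borel_measurable F" using sets.top[of F] F(1) by simp
  qed
  moreover have "AE w in M. real_cond_exp M F (indicat_real (space M)) w
        = measure (uniform_measure (eucl n) (D (N w))) (space (eucl n))"
    using Yc[OF sets.top] by (simp add: sp)
  ultimately show "AE w in M. measure (uniform_measure (eucl n) (D (N w))) (space (eucl n)) = 1"
    using AE_space by eventually_elim simp
qed

theorem uniform_zero_cell_ball_prob:
  assumes N: "stationary_poisson_process n l M N" and Y: "cond_uniform_on n M N Y (centered_zero_cell n)"
    and "n \<ge> 1" "r \<ge> 0"
  shows "measure M {w \<in> space M. enorm n (Y w) \<le> r} = 1 - exp (- (l * (unit_ball_vol n * r ^ n)))"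
proof -
  interpret M: prob_space M by (rule poisson_processD(2)[OF N])
  note [measurable] = poisson_processD(3)[OF N]
  let ?D = "\<lambda>w. centered_zero_cell n (N w)"
  let ?A = "{x \<in> space (eucl n). enorm n x \<le> r}"
  have A: "?A \<in> sets (eucl n)" by measurable
  note cu = cond_uniform_on_prob[OF M.prob_space_axioms poisson_processD(3)[OF N] Y]
  have "AE w in M. ennreal (measure (uniform_measure (eucl n) (?D w)) ?A) = (\<integral>\<^sup>+t. mass_out n r t (N w) \<partial>eucl n)
    \<and> (\<integral>\<^sup>+t. mass_in n r t (N w) \<partial>eucl n) = indicator {w \<in> space M. hit n (origin n) r (N w)} w"
    using cu(2)[OF A] poisson_nonempty[OF N \<open>n \<ge> 1\<close>] poisson_no_ties[OF N \<open>n \<ge> 1\<close>] AE_space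
  proof eventually_elim
    case (elim w)
    have "\<And>x y. x \<in> N w \<Longrightarrow> y \<in> N w \<Longrightarrow> enorm n x = enorm n y \<Longrightarrow> x = y" using elim(3) by blast
    note z = zero_cell_mass[OF poisson_locally_finite[OF N elim(4)] elim(2) this]
    note D = z(1)
    have "?D w \<subseteq> space (eucl n)" using D by (rule sets.sets_into_space)
    then have "emeasure (uniform_measure (eucl n) (?D w)) (space (eucl n)) = emeasure (eucl n) (?D w) / emeasure (eucl n) (?D w)"
      using emeasure_uniform_measure[OF D sets.top] by (simp only: Int_absorb2)
    then have one: "enn2real (emeasure (eucl n) (?D w) / emeasure (eucl n) (?D w)) = 1"
      using elim(1) unfolding measure_def by simp
    \<comment> \<open>In \<open>ennreal\<close> both 0 / 0 and infinity / infinity are 0, so a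
      quotient of 1 excludes both volumes.\<close>
    have ne: "emeasure (eucl n) (?D w) \<noteq> 0" "emeasure (eucl n) (?D w) \<noteq> \<infinity>"
      using one by (auto simp: ennreal_divide_top)
    interpret U: prob_space "uniform_measure (eucl n) (?D w)"
      using ne by (rule prob_space_uniform_measure)
    have self: "emeasure (eucl n) (?D w) / emeasure (eucl n) (?D w) = 1"
      using ne by (intro ennreal_divide_self) (auto simp: less_top)
    have "ennreal (measure (uniform_measure (eucl n) (?D w)) ?A) = (\<integral>\<^sup>+t. mass_out n r t (N w) \<partial>eucl n)"
      using emeasure_uniform_measure[OF D A] z(2)[where r = r] by (simp only: U.emeasure_eq_measure)
    moreover have "(\<integral>\<^sup>+t. mass_in n r t (N w) \<partial>eucl n) = indicator {w \<in> space M. hit n (origin n) r (N w)} w"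
      using z(3)[where r = r] self elim(4) by (simp only: indicator_def mem_Collect_eq) simp
    ultimately show ?case ..
  qed
  then have AE: "AE w in M. ennreal (measure (uniform_measure (eucl n) (?D w)) ?A) = (\<integral>\<^sup>+t. mass_out n r t (N w) \<partial>eucl n)"
    "AE w in M. (\<integral>\<^sup>+t. mass_in n r t (N w) \<partial>eucl n) = indicator {w \<in> space M. hit n (origin n) r (N w)} w"
    by auto
  have "Y \<in> measurable M (eucl n)" using Y by (simp add: cond_uniform_on_def)
  then have "{w \<in> space M. Y w \<in> ?A} = {w \<in> space M. enorm n (Y w) \<le> r}"
    by (auto dest: measurable_space)
  then have "emeasure M {w \<in> space M. enorm n (Y w) \<le> r} = (\<integral>\<^sup>+w. \<integral>\<^sup>+t. mass_out n r t (N w) \<partial>eucl n \<partial>M)"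
    using cu(1)[OF A] nn_integral_cong_AE[OF AE(1)] by simp
  also have "\<dots> = (\<integral>\<^sup>+w. indicator {w \<in> space M. hit n (origin n) r (N w)} w \<partial>M)"
    unfolding mass_transport[OF N] by (rule nn_integral_cong_AE[OF AE(2)])
  also have "\<dots> = emeasure M {w \<in> space M. hit n (origin n) r (N w)}"
    by (rule nn_integral_indicator) measurable
  finally have "M.prob {w \<in> space M. enorm n (Y w) \<le> r} = M.prob {w \<in> space M. hit n (origin n) r (N w)}"
    by (simp add: M.emeasure_eq_measure)
  then show ?thesis by (simp add: poisson_hit_prob[OF N assms(3,4)])
qed

subsection \<open>Asymptotics\<close>

text \<open>The complement is the open ball, whereas the known formula is for closed balls. It is
  continuous in the radius, so closed balls from inside give the open ball the same
  probability.\<close>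

lemma poisson_uniform_tail:
  assumes N: "stationary_poisson_process n l M N" and Y: "cond_uniform_on n M N Y (centered_zero_cell n)"
    and "n \<ge> 1" "r > 0"
  shows "measure M {w \<in> space M. enorm n (Y w) \<ge> r} = exp (- (l * (unit_ball_vol n * r ^ n)))"
proof -
  interpret M: prob_space M by (rule poisson_processD(2)[OF N])
  have [measurable]: "Y \<in> measurable M (eucl n)" using Y by (simp add: cond_uniform_on_def)
  note ball = uniform_zero_cell_ball_prob[OF N Y \<open>n \<ge> 1\<close>]
  let ?p = "\<lambda>r. exp (- (l * (unit_ball_vol n * r ^ n)))"
  \<comment> \<open>Radii that converge to \<open>r\<close> from strictly below and start at 0, so
    they are never negative.\<close>
  let ?s = "\<lambda>k. r * (1 - 1 / real (Suc k))"
  have s: "0 \<le> ?s k" "?s k < r" for k using \<open>r > 0\<close> by (auto simp: field_simps)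
  have open_ge: "1 - ?p (?s k) \<le> M.prob {w \<in> space M. enorm n (Y w) < r}" for k
  proof -
    have "M.prob {w \<in> space M. enorm n (Y w) \<le> ?s k} \<le> M.prob {w \<in> space M. enorm n (Y w) < r}"
      using s(2)[of k] by (intro M.finite_measure_mono) auto
    then show ?thesis unfolding ball[OF s(1)] .
  qed
  have "(\<lambda>k. 1 / real (Suc k)) \<longlonglongrightarrow> 0" by (intro LIMSEQ_Suc[OF lim_const_over_n])
  then have "(\<lambda>k. 1 - ?p (?s k)) \<longlonglongrightarrow> 1 - ?p (r * (1 - 0))" by (intro tendsto_intros)
  then have "1 - ?p r \<le> M.prob {w \<in> space M. enorm n (Y w) < r}"
    by (intro LIMSEQ_le_const2[where X = "\<lambda>k. 1 - ?p (?s k)"]) (use open_ge in auto)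
  moreover have "M.prob {w \<in> space M. enorm n (Y w) < r} \<le> 1 - ?p r"
  proof -
    have "M.prob {w \<in> space M. enorm n (Y w) < r} \<le> M.prob {w \<in> space M. enorm n (Y w) \<le> r}"
      by (intro M.finite_measure_mono) auto
    then show ?thesis using ball[of r] \<open>r > 0\<close> by simp
  qed
  ultimately have "M.prob {w \<in> space M. enorm n (Y w) < r} = 1 - ?p r" by simp
  moreover have "{w \<in> space M. enorm n (Y w) \<ge> r} = space M - {w \<in> space M. enorm n (Y w) < r}" by auto
  moreover have "M.prob (space M - {w \<in> space M. enorm n (Y w) < r}) = 1 - M.prob {w \<in> space M. enorm n (Y w) < r}"
    by (rule M.prob_compl) measurable
  ultimately show ?thesis by simp
qed

text \<open>A Stolz-Cesaro argument with step two, as the volume recursion links dimensions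
  \<open>n\<close> and \<open>n + 2\<close>. Once the drift \<open>L * real n\<close> is subtracted,
  each step eventually adds an arbitrarily small amount, so the remainder is sublinear.\<close>

lemma tendsto_div_of_diff2:
  fixes c :: "nat \<Rightarrow> real"
  assumes "(\<lambda>n. c (n + 2) - c n) \<longlonglongrightarrow> 2 * L"
  shows "(\<lambda>n. c n / real n) \<longlonglongrightarrow> L"
proof (rule LIMSEQ_I)
  fix e :: real assume "e > 0"
  define d where "d n = c n - L * real n" for n
  have "\<exists>N. \<forall>n\<ge>N. norm ((c (n + 2) - c n) - 2 * L) < e / 2"
    using \<open>e > 0\<close> by (intro LIMSEQ_D[OF assms]) auto
  then obtain N where N: "\<And>n. n \<ge> N \<Longrightarrow> \<bar>d (n + 2) - d n\<bar> \<le> e / 2"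
    by (auto simp: d_def algebra_simps intro: less_imp_le)
  \<comment> \<open>Two starting values, one for each parity of the induction in steps of
    two.\<close>
  define K where "K = \<bar>d N\<bar> + \<bar>d (N + 1)\<bar>"
  have bound: "\<bar>d n\<bar> \<le> K + e / 2 * real n" if "n \<ge> N" for n
    using that
  proof (induction n rule: less_induct)
    case (less n)
    have pos: "0 \<le> e / 2 * real n" using \<open>e > 0\<close> by simp
    consider "n = N" | "n = N + 1" | "n \<ge> N + 2" using less.prems by linarith
    then show ?case
    proof cases
      case 3
      then obtain m where m: "n = m + 2" "m \<ge> N" by (metis add_leD2 le_Suc_ex add.commute add.left_commute le_add1)
      have "\<bar>d m\<bar> \<le> K + e / 2 * real m" using m by (intro less.IH) auto
      moreover have "\<bar>d n\<bar> \<le> \<bar>d m\<bar> + e / 2" using N[OF m(2)] unfolding m(1) by linarith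
      moreover have "e / 2 * real n = e / 2 * real m + e" using m by (simp add: algebra_simps)
      ultimately show ?thesis using \<open>e > 0\<close> by linarith
    qed (use pos in \<open>auto simp: K_def\<close>)
  qed
  have "(\<lambda>n. K / real n) \<longlonglongrightarrow> 0" by (rule lim_const_over_n)
  then have "\<exists>n0. \<forall>n\<ge>n0. norm (K / real n - 0) < e / 2"
    using \<open>e > 0\<close> by (intro LIMSEQ_D) auto
  then obtain n0 where n0: "\<And>n. n \<ge> n0 \<Longrightarrow> \<bar>K / real n\<bar> < e / 2" by auto
  show "\<exists>no. \<forall>n\<ge>no. norm (c n / real n - L) < e"
  proof (intro exI[of _ "max (Suc N) n0"] allI impI)
    fix n assume n: "n \<ge> max (Suc N) n0"
    then have "n > 0" by simp
    have "\<bar>c n / real n - L\<bar> = \<bar>d n\<bar> / real n" using \<open>n > 0\<close> by (simp add: d_def field_simps abs_divide)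
    also have "\<dots> \<le> (K + e / 2 * real n) / real n" using bound[of n] n by (intro divide_right_mono) auto
    also have "\<dots> = K / real n + e / 2" using \<open>n > 0\<close> by (simp add: field_simps)
    also have "\<dots> < e" using abs_ge_self[of "K / real n"] n0[of n] n by linarith
    finally show "norm (c n / real n - L) < e" by simp
  qed
qed

section \<open>Growth rate of the volume of the unit ball\<close>

lemma unit_ball_vol_plus2: "unit_ball_vol (real (n + 2)) = unit_ball_vol (real n) * (2 * pi / real (n + 2))"
proof -
  have "Gamma (real n / 2 + 1 + 1) = (real n / 2 + 1) * Gamma (real n / 2 + 1)"
    by (intro Gamma_plus1) (auto elim!: nonpos_Ints_cases simp: field_simps)
  then have G: "Gamma (real (n + 2) / 2 + 1) = (real (n + 2) / 2) * Gamma (real n / 2 + 1)"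
    by (simp add: add_divide_distrib add_ac)
  have P: "pi powr (real (n + 2) / 2) = pi powr (real n / 2) * pi"
    by (simp add: add_divide_distrib powr_add)
  have "p * pi / (x / 2 * g) = p / g * (2 * pi / x)" for p g x :: real by (simp add: mult_ac)
  then show ?thesis unfolding unit_ball_vol_def G P .
qed

text \<open>The term \<open>real n / 2 * ln (real n)\<close> is what the radius
  \<open>sqrt (real n)\<close> contributes. Over two dimensions it grows by
  \<open>ln (real n + 2) + 1\<close> up to a vanishing error: the logarithm cancels the one from the
  recursion, and the 1 is the origin of \<open>exp 1\<close> in the constant.\<close>

lemma ln_unit_ball_vol_asymp:
  "(\<lambda>n. (ln (unit_ball_vol (real n)) + real n / 2 * ln (real n)) / real n) \<longlonglongrightarrow> 1 / 2 * ln (2 * pi * exp 1)"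
proof (rule tendsto_div_of_diff2)
  let ?c = "\<lambda>n. ln (unit_ball_vol (real n)) + real n / 2 * ln (real n)"
  have "(\<lambda>n. (ln (2 * pi) - ln (real n + 2)) + ((real n + 2) / 2 * ln (real n + 2) - real n / 2 * ln (real n)))
    \<longlonglongrightarrow> ln (2 * pi) + 1"
    by real_asymp
  moreover have "?c (n + 2) - ?c n = (ln (2 * pi) - ln (real n + 2)) + ((real n + 2) / 2 * ln (real n + 2) - real n / 2 * ln (real n))" for n
  proof -
    have "ln (unit_ball_vol (real (n + 2))) = ln (unit_ball_vol (real n)) + ln (2 * pi / real (n + 2))"
      unfolding unit_ball_vol_plus2 by (rule ln_mult_pos) auto
    also have "ln (2 * pi / real (n + 2)) = ln (2 * pi) - ln (real n + 2)"
      by (subst ln_divide_pos) (auto simp: add.commute)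
    finally show ?thesis by (simp add: algebra_simps add_divide_distrib)
  qed
  moreover have "2 * (1 / 2 * ln (2 * pi * exp 1)) = ln (2 * pi) + 1"
    by (simp add: ln_mult_pos)
  ultimately show "(\<lambda>n. ?c (n + 2) - ?c n) \<longlonglongrightarrow> 2 * (1 / 2 * ln (2 * pi * exp 1))" by (simp only:)
qed

text \<open>For small \<open>a\<close> the probability agrees with \<open>a\<close> up to a factor
  2, which is invisible after taking the logarithm and dividing by \<open>n\<close>.\<close>

lemma one_minus_exp_bounds:
  fixes a :: real
  assumes "0 \<le> a"
  shows "1 - exp (- a) \<le> a" and "a \<le> 1 \<Longrightarrow> a / 2 \<le> 1 - exp (- a)"
proof -
  show "1 - exp (- a) \<le> a" using exp_ge_add_one_self[of "- a"] by simp
  assume "a \<le> 1"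
  have "exp (- a) = 1 / exp a" by (simp add: exp_minus field_simps)
  also have "\<dots> \<le> 1 / (1 + a)" using assms exp_ge_add_one_self[of a] by (intro divide_left_mono) auto
  also have "\<dots> \<le> 1 - a / 2"
  proof -
    have "a * a \<le> a * 1" using assms \<open>a \<le> 1\<close> by (intro mult_left_mono)
    then have "1 \<le> (1 - a / 2) * (1 + a)" by (simp add: algebra_simps)
    then show ?thesis using assms by (simp add: pos_divide_le_eq)
  qed
  finally show "a / 2 \<le> 1 - exp (- a)" by simp
qed

text \<open>The logarithm is taken of the expected number of points in the ball of radius
  \<open>sqrt (real n) * R\<close>; it splits into contributions of the intensity, the unit ball,
  the factor \<open>sqrt (real n)\<close> and \<open>R\<close>.\<close>

lemma expected_count_asymp:
  fixes rho :: "nat \<Rightarrow> real"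
  assumes "rho \<longlonglongrightarrow> \<rho>" "R > 0"
  shows "(\<lambda>n. 1 / real n * ln (exp (real n * rho n) * (unit_ball_vol (real n) * (sqrt (real n) * R) ^ n)))
    \<longlonglongrightarrow> \<rho> + 1 / 2 * ln (2 * pi * exp 1) + ln R"
proof -
  have "(\<lambda>n. rho n + (ln (unit_ball_vol (real n)) + real n / 2 * ln (real n)) / real n + ln R)
    \<longlonglongrightarrow> \<rho> + 1 / 2 * ln (2 * pi * exp 1) + ln R"
    by (intro tendsto_add assms(1) ln_unit_ball_vol_asymp tendsto_const)
  moreover have "\<forall>\<^sub>F n in sequentially. rho n + (ln (unit_ball_vol (real n)) + real n / 2 * ln (real n)) / real n + ln R
    = 1 / real n * ln (exp (real n * rho n) * (unit_ball_vol (real n) * (sqrt (real n) * R) ^ n))"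
    using eventually_gt_at_top[of 0]
  proof eventually_elim
    case (elim n)
    have "ln (exp (real n * rho n) * (unit_ball_vol (real n) * (sqrt (real n) * R) ^ n))
      = real n * rho n + (ln (unit_ball_vol (real n)) + real n * (ln (real n) / 2 + ln R))"
      using elim \<open>R > 0\<close> by (simp add: ln_mult_pos ln_realpow ln_sqrt)
    then show ?case using elim by (simp add: field_simps)
  qed
  ultimately show ?thesis by (rule Lim_transform_eventually)
qed

theorem theorem3p2:
  fixes M :: "nat \<Rightarrow> 'a measure"
    and N :: "nat \<Rightarrow> 'a \<Rightarrow> (nat \<Rightarrow> real) set"
    and Y :: "nat \<Rightarrow> 'a \<Rightarrow> (nat \<Rightarrow> real)"
    and rho :: "nat \<Rightarrow> real" and \<rho> R :: real
  assumes "\<And>n. n \<ge> 1 \<Longrightarrow> stationary_poisson_process n (exp (real n * rho n)) (M n) (N n)"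
    and "\<And>n. n \<ge> 1 \<Longrightarrow> cond_uniform_on n (M n) (N n) (Y n) (centered_zero_cell n)"
    and "rho \<longlonglongrightarrow> \<rho>"
    and "R > 0"
  shows "(R < exp (- \<rho>) * (2 * pi * exp 1) powr (- 1 / 2) \<longrightarrow>
            (\<lambda>n. \<P>(w in M n. enorm n (Y n w) \<le> sqrt (real n) * R)) \<longlonglongrightarrow> 0) \<and>
         (R > exp (- \<rho>) * (2 * pi * exp 1) powr (- 1 / 2) \<longrightarrow>
            (\<lambda>n. \<P>(w in M n. enorm n (Y n w) \<le> sqrt (real n) * R)) \<longlonglongrightarrow> 1) \<and>
         (R < exp (- \<rho>) * (2 * pi * exp 1) powr (- 1 / 2) \<longrightarrow>
            (\<lambda>n. 1 / real n * ln (\<P>(w in M n. enorm n (Y n w) \<le> sqrt (real n) * R)))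
              \<longlonglongrightarrow> \<rho> + 1 / 2 * ln (2 * pi * exp 1) + ln R) \<and>
         (R > exp (- \<rho>) * (2 * pi * exp 1) powr (- 1 / 2) \<longrightarrow>
            (\<lambda>n. 1 / real n * ln (- ln (\<P>(w in M n. enorm n (Y n w) \<ge> sqrt (real n) * R))))
              \<longlonglongrightarrow> \<rho> + 1 / 2 * ln (2 * pi * exp 1) + ln R)"
proof -
  define L where "L = \<rho> + 1 / 2 * ln (2 * pi * exp 1) + ln R"
  define a where "a n = exp (real n * rho n) * (unit_ball_vol (real n) * (sqrt (real n) * R) ^ n)" for n
  have a_pos: "a n > 0" if "n > 0" for n using that \<open>R > 0\<close> by (simp add: a_def)
  have a_lim: "(\<lambda>n. 1 / real n * ln (a n)) \<longlonglongrightarrow> L"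
    unfolding a_def L_def by (rule expected_count_asymp[OF assms(3,4)])
  have a_exp: "\<forall>\<^sub>F n in sequentially. a n = exp (real n * (1 / real n * ln (a n)))"
    using eventually_gt_at_top[of 0] by eventually_elim (simp add: a_pos)
  have le: "\<forall>\<^sub>F n in sequentially. 1 - exp (- a n) = \<P>(w in M n. enorm n (Y n w) \<le> sqrt (real n) * R)"
    using eventually_ge_at_top[of 1]
    by eventually_elim (use \<open>R > 0\<close> in \<open>simp add: a_def uniform_zero_cell_ball_prob[OF assms(1,2)]\<close>)
  have ge: "\<forall>\<^sub>F n in sequentially. exp (- a n) = \<P>(w in M n. enorm n (Y n w) \<ge> sqrt (real n) * R)"
    using eventually_ge_at_top[of 1]
    by eventually_elim (use \<open>R > 0\<close> in \<open>simp add: a_def poisson_uniform_tail[OF assms(1,2)]\<close>)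
  \<comment> \<open>\<open>L\<close> vanishes exactly at the threshold radius. In this form,
    comparing \<open>R\<close> with the threshold reads off the sign of \<open>L\<close>.\<close>
  have thr: "exp (- \<rho>) * (2 * pi * exp 1) powr (- 1 / 2) = R * exp (- L)"
  proof -
    have "exp (- L) = exp (- \<rho>) * exp (- 1 / 2 * ln (2 * pi * exp 1)) * exp (- ln R)"
      by (simp add: L_def exp_add[symmetric])
    then show ?thesis using \<open>R > 0\<close> by (simp add: powr_def exp_minus[of "ln R"])
  qed
  show ?thesis
    unfolding thr L_def[symmetric]
  proof (intro conjI impI)
    assume "R < R * exp (- L)"
    then have "L < 0" using \<open>R > 0\<close> by simp
    \<comment> \<open>Left uncancelled, the expression shows \<open>ln (a n)\<close> as
      \<open>n\<close> times a sequence with negative limit.\<close>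
    have "filterlim (\<lambda>n. real n * (1 / real n * ln (a n))) at_bot sequentially"
      using \<open>L < 0\<close> by (subst mult.commute, intro filterlim_tendsto_neg_mult_at_bot[OF a_lim] filterlim_real_sequentially)
    then have "(\<lambda>n. exp (real n * (1 / real n * ln (a n)))) \<longlonglongrightarrow> 0"
      by (rule filterlim_compose[OF exp_at_bot])
    then have a0: "a \<longlonglongrightarrow> 0"
      by (rule Lim_transform_eventually) (use a_exp in eventually_elim, simp)
    have "(\<lambda>n. 1 - exp (- a n)) \<longlonglongrightarrow> 1 - exp (- 0)" by (intro tendsto_intros a0)
    then show "(\<lambda>n. \<P>(w in M n. enorm n (Y n w) \<le> sqrt (real n) * R)) \<longlonglongrightarrow> 0"
      using le by (simp add: Lim_transform_eventually)
    have a1: "\<forall>\<^sub>F n in sequentially. a n < 1" using a0 by (rule order_tendstoD) simp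
    \<comment> \<open>The rate of \<open>a n / 2\<close>, which bounds the probability from below as
      soon as \<open>a n\<close> is at most 1.\<close>
    have "(\<lambda>n. 1 / real n * ln (a n) - ln 2 / real n) \<longlonglongrightarrow> L - 0"
      by (intro tendsto_diff a_lim lim_const_over_n)
    then have low: "(\<lambda>n. 1 / real n * ln (a n) - ln 2 / real n) \<longlonglongrightarrow> L" by simp
    have "(\<lambda>n. 1 / real n * ln (1 - exp (- a n))) \<longlonglongrightarrow> L"
    proof (rule tendsto_sandwich[OF _ _ low a_lim])
      show "\<forall>\<^sub>F n in sequentially. 1 / real n * ln (a n) - ln 2 / real n \<le> 1 / real n * ln (1 - exp (- a n))"
        using a1 eventually_gt_at_top[of 0]
      proof eventually_elim
        case (elim n)
        have "ln (a n / 2) \<le> ln (1 - exp (- a n))"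
          using a_pos[OF elim(2)] elim(1) one_minus_exp_bounds(2)[of "a n"] by (subst ln_le_cancel_iff) auto
        then have "1 / real n * ln (a n / 2) \<le> 1 / real n * ln (1 - exp (- a n))"
          by (intro mult_left_mono) auto
        then show ?case using a_pos[OF elim(2)] by (simp add: ln_div diff_divide_distrib)
      qed
      show "\<forall>\<^sub>F n in sequentially. 1 / real n * ln (1 - exp (- a n)) \<le> 1 / real n * ln (a n)"
        using eventually_gt_at_top[of 0]
      proof eventually_elim
        case (elim n)
        then show ?case
          using a_pos[OF elim] one_minus_exp_bounds(1)[of "a n"]
          by (intro mult_left_mono) auto
      qed
    qed
    then show "(\<lambda>n. 1 / real n * ln (\<P>(w in M n. enorm n (Y n w) \<le> sqrt (real n) * R))) \<longlonglongrightarrow> L"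
      by (rule Lim_transform_eventually) (use le in eventually_elim, simp)
  next
    assume "R > R * exp (- L)"
    then have "L > 0" using \<open>R > 0\<close> by simp
    have "filterlim (\<lambda>n. real n * (1 / real n * ln (a n))) at_top sequentially"
      using \<open>L > 0\<close> by (subst mult.commute, intro filterlim_tendsto_pos_mult_at_top[OF a_lim] filterlim_real_sequentially)
    then have "filterlim (\<lambda>n. exp (real n * (1 / real n * ln (a n)))) at_top sequentially"
      by (rule filterlim_compose[OF exp_at_top])
    then have a_inf: "filterlim a at_top sequentially"
      by (rule filterlim_cong[OF refl refl, THEN iffD1, rotated]) (use a_exp in eventually_elim, simp)
    have "(\<lambda>n. exp (- a n)) \<longlonglongrightarrow> 0"
      by (rule filterlim_compose[OF exp_at_bot filterlim_uminus_at_top[THEN iffD1, OF a_inf]])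
    then have "(\<lambda>n. 1 - exp (- a n)) \<longlonglongrightarrow> 1 - 0" by (intro tendsto_intros)
    then show "(\<lambda>n. \<P>(w in M n. enorm n (Y n w) \<le> sqrt (real n) * R)) \<longlonglongrightarrow> 1"
      using le by (simp add: Lim_transform_eventually)
    \<comment> \<open>The tail is exactly \<open>exp (- a n)\<close>, so the double logarithm
      returns \<open>ln (a n)\<close> and no estimate is involved.\<close>
    show "(\<lambda>n. 1 / real n * ln (- ln (\<P>(w in M n. enorm n (Y n w) \<ge> sqrt (real n) * R)))) \<longlonglongrightarrow> L"
      using a_lim by (rule Lim_transform_eventually) (use ge in eventually_elim, metis ln_exp minus_minus)
  qed
qed

end
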